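(* Assume that (i) the set $A(x)$ is compact for every $x\in X$; (ii) $c:\mathbb K\to\mathbb R$ is lower semicontinuous, nonnegative and inf-compact on $\mathbb K$; (iii) $Q$ is strongly Feller; and that the action space $A$ is locally compact. Let $\hat\pi=(\hat f_n)_{n\ge0}$ be an $\alpha$-VI policy. Then there exists a selector $\hat f\in\mathbb F$ such that for every $x\in X\setminus K$, $\hat f(x)\in A(x)$ is an accumulation point of the sequence $(\hat f_n(x))_{n\ge0}$, and the corresponding deterministic stationary policy $\hat f^\infty$ is $\alpha$-discount optimal.
   Context: Control model. $X$ (state space) and $A$ (action set) are nonempty Borel subsets of Polish spaces. For each $x\in X$, $A(x)\subseteq A$ is a nonempty measurable set of feasible actions; the set $\{(x,a): x\in X,\ a\in A(x)\}$ is a measurable subset of $X\times A$ and contains the graph of a measurable function from $X$ to $A$. $Q$ is a stochastic kernel on $X$ given the feasible state-action pairs (the transition law). $K\subseteq X$ is a measurable target set (not assumed absorbing), $\mathbb K:=\{(x,a)\in X\times A: x\in X\setminus K,\ a\in A(x)\}$, and $c:\mathbb K\to\mathbb R$ is a measurable cost-per-stage function. $\alpha\in(0,1)$ is fixed. "Measurable" means Borel-measurable. $\mathbb F$ is the set of selectors, i.e. measurable $f:X\setminus K\to A$ with $f(x)\in A(x)$ for all $x\in X\setminus K$; one writes $c(x,f):=c(x,f(x))$ and $Q(\cdot\mid x,f):=Q(\cdot\mid x,f(x))$. Policies and process. $\tau:=\inf\{i\ge 0: x_i\in K\}$ (with $\inf\emptyset=+\infty$). The process is controlled only up to $\tau$: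 a policy $\pi=(\varphi_t)_{t\ge0}$ in the class $\Pi$ (randomized Markov policies) is a sequence of stochastic kernels $\varphi_t$ on $A$ with $\varphi_t(A(x)\mid x)=1$ for $x\in X\setminus K$. Under $\mathsf P^\pi_x$ one has $x_0=x$ and, on $\{t<\tau\}$, conditionally on the history up to time $t$, $a_t\sim\varphi_t(\cdot\mid x_t)$ and then $x_{t+1}\sim Q(\cdot\mid x_t,a_t)$. For $f\in\mathbb F$, $f^\infty$ denotes the deterministic stationary policy with $a_t=f(x_t)$ for all $t<\tau$. Costs. $V(\pi,x):=\mathsf E^\pi_x\big[\sum_{i=0}^{\tau-1}\alpha^i c(x_i,a_i)\big]$ and $V^\star(x):=\inf_{\pi\in\Pi}V(\pi,x)$, $x\in X\setminus K$. A policy $\pi$ is $\alpha$-discount optimal if $V(\pi,x)=V^\star(x)$ for all $x\in X\setminus K$. The $\alpha$-value iteration functions are $v_0:=0$ and, for $n\ge1$ and $x\in X\setminus K$, $v_n(x):=\min_{a\in A(x)}\big[c(x,a)+\alpha\int_{X\setminus K}Q(\mathrm dy\mid x,a)\,v_{n-1}(y)\big]$. $\alpha$-VI policy. A deterministic Markov policy $\hat\pi=(\hat f_n)_{n\ge0}$ with $\hat f_n\in\mathbb F$ such that $\hat f_0\in\mathbb F$ is arbitrary and, for $n\ge1$, $v_n(x)=c(x,\hat f_n)+\alpha\int_{X\setminus K}Q(\mathrm dy\mid x,\hat f_n)\,v_{n-1}(y)$ for all $x\in X\setminus K$. Regularity notions. A function $g:\mathbb K\to\mathbb R$ is lower semicontinuous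 if $\liminf_j g(x_j,a_j)\ge g(x,a)$ whenever $(x_j,a_j)\to(x,a)$ in $\mathbb K$; it is inf-compact on $\mathbb K$ if for every $x\in X\setminus K$ and $r\in\mathbb R$ the set $\{a\in A(x): g(x,a)\le r\}$ is compact. $Q$ is strongly Feller if for every bounded measurable $g:X\to\mathbb R$ the map $(x,a)\mapsto\int_X g(y)\,Q(\mathrm dy\mid x,a)$ is continuous and bounded on $\mathbb K$. *)

theory Defs
  imports "HOL-Probability.Probability"
begin

section \<open>Control models\<close>

text \<open>The state space and the action set are subsets of Polish spaces, which are the types
  \<open>'x\<close> and \<open>'a\<close>. Functions are total in HOL: \<open>feasible\<close> is only relevant on \<open>states\<close>, \<open>law\<close> only
  on the feasible pairs, and \<open>cost\<close> only on the feasible pairs with state outside \<open>target\<close>.\<close>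

record ('x, 'a) model =
  states :: "'x set"
  actions :: "'a set"
  feasible :: "'x \<Rightarrow> 'a set"
  law :: "'x \<times> 'a \<Rightarrow> 'x measure"
  target :: "'x set"
  cost :: "'x \<times> 'a \<Rightarrow> real"

definition state_space :: "('x::polish_space, 'a::polish_space) model \<Rightarrow> 'x measure" where
  "state_space M = restrict_space borel (states M)"

definition action_space :: "('x::polish_space, 'a::polish_space) model \<Rightarrow> 'a measure" where
  "action_space M = restrict_space borel (actions M)"

definition pair_space :: "('x::polish_space, 'a::polish_space) model \<Rightarrow> ('x \<times> 'a) measure" where
  "pair_space M = state_space M \<Otimes>\<^sub>M action_space M"

definition live :: "('x, 'a) model \<Rightarrow> 'x set" where
  "live M = states M - target M"

definition live_space :: "('x::polish_space, 'a::polish_space) model \<Rightarrow> 'x measure" where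
  "live_space M = restrict_space borel (live M)"

definition feasible_pairs :: "('x, 'a) model \<Rightarrow> ('x \<times> 'a) set" where
  "feasible_pairs M = {(x, a). x \<in> states M \<and> a \<in> feasible M x}"

definition live_pairs :: "('x, 'a) model \<Rightarrow> ('x \<times> 'a) set" where
  "live_pairs M = {(x, a). x \<in> live M \<and> a \<in> feasible M x}"

definition control_model :: "('x::polish_space, 'a::polish_space) model \<Rightarrow> bool" where
  "control_model M \<longleftrightarrow>
     states M \<in> sets borel \<and> states M \<noteq> {} \<and>
     actions M \<in> sets borel \<and> actions M \<noteq> {} \<and>
     (\<forall>x\<in>states M. feasible M x \<in> sets (action_space M) \<and> feasible M x \<noteq> {}) \<and>
     feasible_pairs M \<in> sets (pair_space M) \<and>
     (\<exists>f \<in> state_space M \<rightarrow>\<^sub>M action_space M. \<forall>x\<in>states M. f x \<in> feasible M x) \<and>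
     law M \<in> restrict_space (pair_space M) (feasible_pairs M) \<rightarrow>\<^sub>M prob_algebra (state_space M) \<and>
     target M \<in> sets (state_space M) \<and>
     cost M \<in> borel_measurable (restrict_space (pair_space M) (live_pairs M))"


section \<open>Policies and the controlled process\<close>

definition selectors :: "('x::polish_space, 'a::polish_space) model \<Rightarrow> ('x \<Rightarrow> 'a) set" where
  "selectors M = {f \<in> live_space M \<rightarrow>\<^sub>M action_space M. \<forall>x\<in>live M. f x \<in> feasible M x}"

definition policies ::
    "('x::polish_space, 'a::polish_space) model \<Rightarrow> (nat \<Rightarrow> 'x \<Rightarrow> 'a measure) set" where
  "policies M =
     {\<phi>. \<forall>t. \<phi> t \<in> live_space M \<rightarrow>\<^sub>M prob_algebra (action_space M) \<and>
            (\<forall>x\<in>live M. emeasure (\<phi> t x) (feasible M x) = 1)}"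

definition stationary ::
    "('x::polish_space, 'a::polish_space) model \<Rightarrow> ('x \<Rightarrow> 'a) \<Rightarrow> (nat \<Rightarrow> 'x \<Rightarrow> 'a measure)" where
  "stationary M f = (\<lambda>t x. return (action_space M) (f x))"

text \<open>A path is a sequence of pairs \<open>(x\<^sub>t, a\<^sub>t)\<close>. The process is controlled only up to the first
  visit to \<open>target\<close>, so that its continuation is immaterial; here the path is frozen from that
  time on, the action recorded at that time being the previous one (a placeholder). The path is
  also frozen at infeasible pairs, which are reached with probability zero; this only makes the
  transition total on \<open>pair_space\<close>.\<close>

definition transition ::
    "('x::polish_space, 'a::polish_space) model \<Rightarrow> (nat \<Rightarrow> 'x \<Rightarrow> 'a measure) \<Rightarrow> nat \<Rightarrow>
       'x \<times> 'a \<Rightarrow> ('x \<times> 'a) measure" where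
  "transition M \<phi> t p =
     (if p \<in> live_pairs M
      then law M p \<bind> (\<lambda>y. if y \<in> target M then return (pair_space M) (y, snd p)
                            else distr (\<phi> t y) (pair_space M) (\<lambda>b. (y, b)))
      else return (pair_space M) p)"

primrec path_kernel ::
    "('x::polish_space, 'a::polish_space) model \<Rightarrow> (nat \<Rightarrow> 'x \<Rightarrow> 'a measure) \<Rightarrow> 'x \<Rightarrow> nat \<Rightarrow>
       (nat \<Rightarrow> 'x \<times> 'a) \<Rightarrow> ('x \<times> 'a) measure" where
  "path_kernel M \<phi> x 0 = (\<lambda>\<omega>. distr (\<phi> 0 x) (pair_space M) (\<lambda>b. (x, b)))"
| "path_kernel M \<phi> x (Suc t) = (\<lambda>\<omega>. transition M \<phi> (Suc t) (\<omega> t))"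

text \<open>The law of the path started in a state outside \<open>target\<close>: the measure on the infinite
  product that the theorem of Ionescu Tulcea yields. (In the locale, \<open>CI\<close> is the family of
  finite-dimensional distributions and this limit is written \<open>PF.lim\<close>.)\<close>

definition path_law ::
    "('x::polish_space, 'a::polish_space) model \<Rightarrow> (nat \<Rightarrow> 'x \<Rightarrow> 'a measure) \<Rightarrow> 'x \<Rightarrow>
       (nat \<Rightarrow> 'x \<times> 'a) measure" where
  "path_law M \<phi> x =
     projective_family.lim UNIV
       (Ionescu_Tulcea.CI (path_kernel M \<phi> x) (\<lambda>_. pair_space M)) (\<lambda>_. pair_space M)"

definition hitting_time :: "('x, 'a) model \<Rightarrow> (nat \<Rightarrow> 'x \<times> 'a) \<Rightarrow> enat" where
  "hitting_time M \<omega> = Inf (enat ` {i. fst (\<omega> i) \<in> target M})"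


section \<open>Discounted costs and value iteration\<close>

text \<open>Costs are meant to be nonnegative on \<open>live_pairs\<close>; total costs and the value iteration
  functions then take values in \<open>[0, \<infinity>]\<close>. For a cost with negative values, \<open>ennreal\<close> would
  truncate, and the notions below would not be the intended ones.\<close>

definition total_cost :: "('x, 'a) model \<Rightarrow> real \<Rightarrow> (nat \<Rightarrow> 'x \<times> 'a) \<Rightarrow> ennreal" where
  "total_cost M \<alpha> \<omega> =
     (\<Sum>i. if enat i < hitting_time M \<omega> then ennreal (\<alpha> ^ i * cost M (\<omega> i)) else 0)"

definition policy_value ::
    "('x::polish_space, 'a::polish_space) model \<Rightarrow> real \<Rightarrow> (nat \<Rightarrow> 'x \<Rightarrow> 'a measure) \<Rightarrow> 'x \<Rightarrow> ennreal"
  where "policy_value M \<alpha> \<phi> x = (\<integral>\<^sup>+ \<omega>. total_cost M \<alpha> \<omega> \<partial>path_law M \<phi> x)"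

definition optimal_value ::
    "('x::polish_space, 'a::polish_space) model \<Rightarrow> real \<Rightarrow> 'x \<Rightarrow> ennreal" where
  "optimal_value M \<alpha> x = (INF \<phi>\<in>policies M. policy_value M \<alpha> \<phi> x)"

definition discount_optimal ::
    "('x::polish_space, 'a::polish_space) model \<Rightarrow> real \<Rightarrow> (nat \<Rightarrow> 'x \<Rightarrow> 'a measure) \<Rightarrow> bool" where
  "discount_optimal M \<alpha> \<phi> \<longleftrightarrow>
     \<phi> \<in> policies M \<and> (\<forall>x\<in>live M. policy_value M \<alpha> \<phi> x = optimal_value M \<alpha> x)"

definition one_step_cost ::
    "('x::polish_space, 'a::polish_space) model \<Rightarrow> real \<Rightarrow> ('x \<Rightarrow> ennreal) \<Rightarrow> 'x \<Rightarrow> 'a \<Rightarrow> ennreal"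
  where
  "one_step_cost M \<alpha> v x a =
     ennreal (cost M (x, a)) + ennreal \<alpha> * (\<integral>\<^sup>+ y \<in> live M. v y \<partial>law M (x, a))"

text \<open>The minimum over the feasible actions is written as an infimum; the definition of a value
  iteration policy below requires that it is attained.\<close>

primrec value_iteration ::
    "('x::polish_space, 'a::polish_space) model \<Rightarrow> real \<Rightarrow> nat \<Rightarrow> 'x \<Rightarrow> ennreal" where
  "value_iteration M \<alpha> 0 = (\<lambda>x. 0)"
| "value_iteration M \<alpha> (Suc n) =
     (\<lambda>x. INF a\<in>feasible M x. one_step_cost M \<alpha> (value_iteration M \<alpha> n) x a)"

definition value_iteration_policy ::
    "('x::polish_space, 'a::polish_space) model \<Rightarrow> real \<Rightarrow> (nat \<Rightarrow> 'x \<Rightarrow> 'a) \<Rightarrow> bool" where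
  "value_iteration_policy M \<alpha> f \<longleftrightarrow>
     (\<forall>n. f n \<in> selectors M) \<and>
     (\<forall>n\<ge>1. \<forall>x\<in>live M.
        value_iteration M \<alpha> n x = one_step_cost M \<alpha> (value_iteration M \<alpha> (n - 1)) x (f n x))"


section \<open>Regularity notions\<close>

definition lower_semicontinuous_on :: "'p::topological_space set \<Rightarrow> ('p \<Rightarrow> real) \<Rightarrow> bool" where
  "lower_semicontinuous_on S g \<longleftrightarrow>
     (\<forall>s p. (\<forall>j. s j \<in> S) \<and> p \<in> S \<and> s \<longlonglongrightarrow> p \<longrightarrow> ereal (g p) \<le> liminf (\<lambda>j. ereal (g (s j))))"

definition inf_compact :: "('x, 'a::topological_space) model \<Rightarrow> ('x \<times> 'a \<Rightarrow> real) \<Rightarrow> bool" where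
  "inf_compact M g \<longleftrightarrow> (\<forall>x\<in>live M. \<forall>r. compact {a \<in> feasible M x. g (x, a) \<le> r})"

definition strongly_Feller :: "('x::polish_space, 'a::polish_space) model \<Rightarrow> bool" where
  "strongly_Feller M \<longleftrightarrow>
     (\<forall>g \<in> borel_measurable (state_space M) :: ('x \<Rightarrow> real) set. bounded (g ` states M) \<longrightarrow>
        continuous_on (live_pairs M) (\<lambda>p. \<integral>y. g y \<partial>law M p) \<and>
        bounded ((\<lambda>p. \<integral>y. g y \<partial>law M p) ` live_pairs M))"

definition accumulation_point :: "(nat \<Rightarrow> 'p::topological_space) \<Rightarrow> 'p \<Rightarrow> bool" where
  "accumulation_point s p \<longleftrightarrow> (\<forall>U. open U \<and> p \<in> U \<longrightarrow> (\<exists>\<^sub>\<infinity>n. s n \<in> U))"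

end

theory Submission
  imports Defs
begin

text \<open>
  Let \<open>v\<^sub>n\<close> be the value iteration functions. They increase, from \<open>v\<^sub>0 = 0\<close>, to a limit \<open>V\<close> with values in
  \<open>[0, \<infinity>]\<close>. The function \<open>v\<^sub>n\<close> is a lower bound for the cost of the first \<open>n\<close> stages under any policy,
  and costs are nonnegative, so \<open>V\<close> is a lower bound for the optimal value
  (\<open>policy_value_ge_value_iteration\<close>). It remains to find a selector \<open>f\<close> of accumulation points with
  \<open>c(x, f) + \<alpha> \<integral> V dQ(x, f) \<le> V(x)\<close>: iterating this inequality gives \<open>policy_value f \<le> V\<close>
  (\<open>policy_value_stationary_le\<close>), and \<open>f\<close> is optimal.

  The inequality holds for every accumulation point \<open>a\<close> of the minimizers
  (\<open>one_step_cost_accumulation_le\<close>). For \<open>m < n\<close>, the minimizer \<open>a\<^sub>n\<close> of stage \<open>n\<close> satisfies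
  \<open>c(x, a\<^sub>n) + \<alpha> \<integral> v\<^sub>m dQ(x, a\<^sub>n) \<le> v\<^sub>n(x) \<le> V(x)\<close>. After truncation of \<open>v\<^sub>m\<close> to a bounded function, the
  integral is continuous in the action by the strong Feller property, and the cost is lower
  semicontinuous; thus the bound survives in the limit \<open>a\<^sub>n \<rightarrow> a\<close> along a subsequence, and then
  monotone convergence replaces the truncation of \<open>v\<^sub>m\<close> by \<open>V\<close>.

  A measurable selector of accumulation points exists because the feasible sets are compact
  (\<open>measurable_accumulation_selector\<close>): in the action space, choose successively balls of radius
  \<open>2\<^sup>-\<^sup>m\<close> around points of a dense sequence, each time with the least possible index, such that
  infinitely many terms of the sequence lie in all balls chosen so far. The centers converge to an
  accumulation point.

  Expectations under the path law reduce to iterated integrals over the transition kernel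
  (\<open>nn_integral_path_0\<close>, \<open>nn_integral_path_Suc\<close>). Since the path is frozen at the target, the expected
  total cost is the discounted sum of the expectations of a cost that vanishes at frozen pairs
  (\<open>policy_value_eq\<close>).
\<close>

section \<open>Measurable selection of accumulation points\<close>

text \<open>The least index \<open>k\<close> such that the ball of radius \<open>e\<close> around \<open>d k\<close> contains \<open>s n\<close> for
  infinitely many \<open>n \<in> S\<close>. It is meaningful only when there is such a \<open>k\<close>. Choosing the least
  index makes the choice measurable in parameters.\<close>

definition center :: "(nat \<Rightarrow> 'p::metric_space) \<Rightarrow> (nat \<Rightarrow> 'p) \<Rightarrow> nat set \<Rightarrow> real \<Rightarrow> nat" where
  "center d s S e = (LEAST k. infinite {n \<in> S. dist (s n) (d k) < e})"

text \<open>The index set that remains after \<open>m\<close> steps, each of which keeps the indices of those terms of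
  \<open>s\<close> that lie in one further ball, with radii \<open>1, 1/2, 1/4, \<dots>\<close>.\<close>

primrec refine :: "(nat \<Rightarrow> 'p::metric_space) \<Rightarrow> (nat \<Rightarrow> 'p) \<Rightarrow> nat \<Rightarrow> nat set" where
  "refine d s 0 = UNIV"
| "refine d s (Suc m) =
     {n \<in> refine d s m. dist (s n) (d (center d s (refine d s m) ((1/2) ^ m))) < (1/2) ^ m}"

lemma infinite_near_center:
  fixes s :: "nat \<Rightarrow> 'p::metric_space"
  assumes "compact K" and "\<And>n. s n \<in> K" and dense: "\<And>U. open U \<Longrightarrow> U \<noteq> {} \<Longrightarrow> \<exists>k. d k \<in> U"
    and "infinite S" and "0 < e"
  shows "infinite {n \<in> S. dist (s n) (d (center d s S e)) < e}"
proof -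
  have "K \<subseteq> (\<Union>k. ball (d k) e)"
  proof
    fix p assume "p \<in> K"
    from dense[of "ball p e"] \<open>0 < e\<close> obtain k where "d k \<in> ball p e" by auto
    then show "p \<in> (\<Union>k. ball (d k) e)" by (auto simp: dist_commute)
  qed
  from compactE_image[OF \<open>compact K\<close> _ this] obtain F where F: "finite F" "K \<subseteq> (\<Union>k\<in>F. ball (d k) e)"
    by auto
  have "\<exists>k. infinite {n \<in> S. dist (s n) (d k) < e}"
  proof (rule ccontr)
    assume "\<not> ?thesis"
    then have "finite (\<Union>k\<in>F. {n \<in> S. dist (s n) (d k) < e})" using F(1) by auto
    moreover have "S \<subseteq> (\<Union>k\<in>F. {n \<in> S. dist (s n) (d k) < e})"
      using F(2) assms(2) by (fastforce simp: dist_commute)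
    ultimately show False using \<open>infinite S\<close> finite_subset by blast
  qed
  then show ?thesis unfolding center_def by (rule LeastI_ex)
qed

lemma measurable_center:
  fixes f :: "nat \<Rightarrow> 'b \<Rightarrow> 'p::{metric_space, second_countable_topology}"
  assumes [measurable]: "\<And>n. f n \<in> borel_measurable N"
    and [measurable]: "\<And>n. Measurable.pred N (\<lambda>x. n \<in> S x)"
  shows "(\<lambda>x. center d (\<lambda>n. f n x) (S x) e) \<in> measurable N (count_space UNIV)"
  unfolding center_def infinite_nat_iff_unbounded mem_Collect_eq by measurable

lemma measurable_refine:
  fixes f :: "nat \<Rightarrow> 'b \<Rightarrow> 'p::{metric_space, second_countable_topology}"
  assumes [measurable]: "\<And>n. f n \<in> borel_measurable N"
  shows "Measurable.pred N (\<lambda>x. n \<in> refine d (\<lambda>n. f n x) m)"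
proof (induction m arbitrary: n)
  case (Suc m)
  note [measurable] = Suc measurable_center[OF assms Suc]
  show ?case by simp
qed simp

text \<open>The centers of the successive balls form a Cauchy sequence, since any two of these balls
  have a common point \<open>f n x\<close>. They depend measurably on \<open>x\<close>, hence so does their limit.\<close>

lemma measurable_accumulation_selector:
  fixes f :: "nat \<Rightarrow> 'b \<Rightarrow> 'p::polish_space"
  assumes f[measurable]: "\<And>n. f n \<in> borel_measurable N"
    and K: "\<And>x. x \<in> space N \<Longrightarrow> compact (K x)"
    and fK: "\<And>x n. x \<in> space N \<Longrightarrow> f n x \<in> K x"
  obtains g where "g \<in> borel_measurable N"
    and "\<And>x. x \<in> space N \<Longrightarrow> g x \<in> K x"
    and "\<And>x. x \<in> space N \<Longrightarrow> accumulation_point (\<lambda>n. f n x) (g x)"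
proof -
  obtain D :: "'p set" where D: "countable D" "\<And>U. open U \<Longrightarrow> U \<noteq> {} \<Longrightarrow> \<exists>p\<in>D. p \<in> U"
    by (rule countable_dense_setE) (rule that)
  from D(2)[of UNIV] have "D \<noteq> {}" by auto
  define d where "d = from_nat_into D"
  have dense: "\<exists>k. d k \<in> U" if "open U" "U \<noteq> {}" for U
    using D(2)[OF that] range_from_nat_into[OF \<open>D \<noteq> {}\<close> D(1)] unfolding d_def by (metis rangeE)
  define c where "c m x = d (center d (\<lambda>n. f n x) (refine d (\<lambda>n. f n x) m) ((1/2) ^ m))" for m x
  define g where "g x = lim (\<lambda>m. c m x)" for x
  have c[measurable]: "c m \<in> borel_measurable N" for m
    unfolding c_def using measurable_center[OF f measurable_refine[OF f]] by measurable
  have inf: "infinite (refine d (\<lambda>n. f n x) m)" if "x \<in> space N" for m x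
  proof (induction m)
    case (Suc m)
    show ?case using infinite_near_center[OF K fK dense Suc] that by simp
  qed simp
  have step: "dist (f n x) (c m x) < (1/2) ^ m" if "n \<in> refine d (\<lambda>n. f n x) (Suc m)" for n m x
    using that by (simp add: c_def)
  have anti: "refine d s j \<subseteq> refine d s m" if "m \<le> j" for s m j
    using that by (induction rule: dec_induct) auto
  have close: "dist (c m x) (c j x) \<le> 2 * (1/2) ^ m" if x: "x \<in> space N" and "m \<le> j" for x m j
  proof -
    from inf[OF x] obtain n where n: "n \<in> refine d (\<lambda>n. f n x) (Suc j)"
      by (metis finite.emptyI ex_in_conv)
    with anti[of "Suc m" "Suc j"] \<open>m \<le> j\<close> have "n \<in> refine d (\<lambda>n. f n x) (Suc m)" by blast
    from step[OF this] step[OF n]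
    have "dist (c m x) (c j x) < (1/2) ^ m + (1/2) ^ j"
      using dist_triangle_less_add[of "c m x" "f n x" _ "c j x"] by (simp add: dist_commute)
    moreover have "(1/2::real) ^ j \<le> (1/2) ^ m" using \<open>m \<le> j\<close> by (intro power_decreasing) auto
    ultimately show ?thesis by linarith
  qed
  have lim: "(\<lambda>m. c m x) \<longlonglongrightarrow> g x" if x: "x \<in> space N" for x
  proof -
    have "Cauchy (\<lambda>m. c m x)"
    proof (rule metric_CauchyI)
      fix e :: real assume "0 < e"
      then obtain m where m: "(1/2) ^ m < e / 4" using real_arch_pow_inv[of "e/4" "1/2"] by auto
      show "\<exists>M. \<forall>i\<ge>M. \<forall>j\<ge>M. dist (c i x) (c j x) < e"
      proof (intro exI allI impI)
        fix i j assume "i \<ge> m" "j \<ge> m"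
        then show "dist (c i x) (c j x) < e"
          using close[OF x, of m i] close[OF x, of m j] m dist_triangle3[of "c i x" "c j x" "c m x"]
          by linarith
      qed
    qed
    then show ?thesis unfolding g_def by (simp add: Cauchy_convergent convergent_LIMSEQ_iff[symmetric])
  qed
  have acc: "accumulation_point (\<lambda>n. f n x) (g x)" if x: "x \<in> space N" for x
    unfolding accumulation_point_def
  proof safe
    fix U assume U: "open U" "g x \<in> U"
    then obtain e where e: "0 < e" "ball (g x) e \<subseteq> U" by (meson openE)
    have "\<forall>\<^sub>F m in sequentially. dist (c m x) (g x) < e / 2 \<and> (1/2::real) ^ m < e / 2"
      using tendstoD[OF lim[OF x], of "e/2"] order_tendstoD(2)[OF LIMSEQ_power_zero[of "1/2::real"], of "e/2"] e(1)
      by (auto intro: eventually_conj)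
    then obtain m where m: "dist (c m x) (g x) < e / 2" "(1/2::real) ^ m < e / 2"
      using eventually_happens by force
    have "f n x \<in> U" if "n \<in> refine d (\<lambda>n. f n x) (Suc m)" for n
      using step[OF that] m e(2) dist_triangle_half_r[of "c m x" "g x" e "f n x"]
      by (auto simp: dist_commute)
    then have "refine d (\<lambda>n. f n x) (Suc m) \<subseteq> {n. f n x \<in> U}" by auto
    then show "\<exists>\<^sub>\<infinity>n. f n x \<in> U"
      unfolding frequently_cofinite using inf[OF x] by (meson finite_subset)
  qed
  have mem: "g x \<in> K x" if x: "x \<in> space N" for x
  proof (rule ccontr)
    assume "g x \<notin> K x"
    with acc[OF x] compact_imp_closed[OF K[OF x]] have "\<exists>\<^sub>\<infinity>n. f n x \<in> - K x"
      unfolding accumulation_point_def by (meson ComplI open_Compl)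
    with fK[OF x] show False by simp
  qed
  have "g \<in> borel_measurable N"
    by (rule borel_measurable_LIMSEQ_metric[OF c lim])
  with mem acc that show thesis by blast
qed

lemma accumulation_point_subsequence:
  fixes s :: "nat \<Rightarrow> 'p::first_countable_topology"
  assumes "accumulation_point s p"
  obtains r :: "nat \<Rightarrow> nat" where "strict_mono r" "(\<lambda>j. s (r j)) \<longlonglongrightarrow> p"
proof -
  obtain A :: "nat \<Rightarrow> 'p set" where A: "\<And>i. open (A i)" "\<And>i. p \<in> A i"
    and Alim: "\<And>S. open S \<Longrightarrow> p \<in> S \<Longrightarrow> \<forall>\<^sub>F i in sequentially. A i \<subseteq> S"
    by (rule countable_basis_at_decseq[of p]) blast
  have ex: "\<exists>n>k. s n \<in> A i" for k i
    using assms A unfolding accumulation_point_def INFM_nat by blast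
  have "\<exists>r. \<forall>i. s (r i) \<in> A i \<and> r i < r (Suc i)"
  proof (rule dependent_nat_choice)
    show "\<exists>n. s n \<in> A 0" using ex by blast
    show "\<exists>n. s n \<in> A (Suc i) \<and> m < n" for m i using ex by blast
  qed
  then obtain r where r: "\<And>i. s (r i) \<in> A i" "\<And>i. r i < r (Suc i)" by blast
  have "(\<lambda>j. s (r j)) \<longlonglongrightarrow> p"
  proof (rule topological_tendstoI)
    fix S assume "open S" "p \<in> S"
    from Alim[OF this] show "\<forall>\<^sub>F j in sequentially. s (r j) \<in> S"
      by (rule eventually_mono) (use r(1) in blast)
  qed
  with r(2) that show thesis by (blast intro: strict_mono_Suc_iff[THEN iffD2])
qed

section \<open>Expectations under an Ionescu-Tulcea limit\<close>

context Ionescu_Tulcea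
begin

text \<open>Under the limit measure, the first \<open>n\<close> coordinates have the law \<open>C 0 n\<close>.\<close>

lemma nn_integral_lim_restrict:
  assumes h[measurable]: "h \<in> borel_measurable (PiM {0..<n} M)"
  shows "(\<integral>\<^sup>+\<omega>. h (restrict \<omega> {0..<n}) \<partial>PF.lim) = (\<integral>\<^sup>+\<omega>. h \<omega> \<partial>C 0 n (\<lambda>_. undefined))"
proof -
  have up: "up_to {0..<n} = n"
  proof (rule antisym)
    show "up_to {0..<n} \<le> n" by (simp add: up_to_iff)
    show "n \<le> up_to {0..<n}" using up_to_iff[of "{0..<n}" "up_to {0..<n}"] by (cases n) auto
  qed
  have "(\<integral>\<^sup>+\<omega>. h (restrict \<omega> {0..<n}) \<partial>PF.lim)
      = (\<integral>\<^sup>+\<omega>. h \<omega> \<partial>distr PF.lim (PiM {0..<n} M) (\<lambda>\<omega>. restrict \<omega> {0..<n}))"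
    by (rule nn_integral_distr[symmetric])
       (simp_all add: measurable_cong_sets[OF PF.sets_lim refl] measurable_restrict_subset del: restrict_apply)
  also have "\<dots> = (\<integral>\<^sup>+\<omega>. h \<omega> \<partial>distr (C 0 n (\<lambda>_. undefined)) (PiM {0..<n} M) (\<lambda>\<omega>. restrict \<omega> {0..<n}))"
    by (simp add: distr_lim CI_def up)
  also have "\<dots> = (\<integral>\<^sup>+\<omega>. h (restrict \<omega> {0..<n}) \<partial>C 0 n (\<lambda>_. undefined))"
    by (rule nn_integral_distr)
       (simp_all add: measurable_cong_sets[OF sets_C refl] measurable_restrict_subset del: restrict_apply)
  also have "\<dots> = (\<integral>\<^sup>+\<omega>. h \<omega> \<partial>C 0 n (\<lambda>_. undefined))"
    by (rule nn_integral_cong) (auto simp: space_C space_PiM)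
  finally show ?thesis .
qed

text \<open>The Markov-type identity on which all later computations rest: coordinate \<open>n\<close> may be integrated
  out with the kernel \<open>P n\<close>, given the coordinates before it.\<close>

lemma nn_integral_lim_Suc:
  assumes h[measurable]: "h \<in> borel_measurable (PiM {0..<Suc n} M)"
  shows "(\<integral>\<^sup>+\<omega>. h (restrict \<omega> {0..<Suc n}) \<partial>PF.lim) =
    (\<integral>\<^sup>+\<omega>. (\<integral>\<^sup>+q. h ((restrict \<omega> {0..<n})(n := q)) \<partial>P n (restrict \<omega> {0..<n})) \<partial>PF.lim)"
proof -
  have "(\<integral>\<^sup>+\<omega>. h (restrict \<omega> {0..<Suc n}) \<partial>PF.lim) = (\<integral>\<^sup>+\<omega>. h \<omega> \<partial>C 0 (Suc n) (\<lambda>_. undefined))"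
    by (rule nn_integral_lim_restrict) fact
  also have "\<dots> = (\<integral>\<^sup>+\<omega>. (\<integral>\<^sup>+\<omega>'. h \<omega>' \<partial>eP n \<omega>) \<partial>C 0 n (\<lambda>_. undefined))"
    by (simp, rule nn_integral_bind[OF h]) (simp add: measurable_cong_sets[OF sets_C refl])
  also have "\<dots> = (\<integral>\<^sup>+\<omega>. (\<integral>\<^sup>+\<omega>'. h \<omega>' \<partial>eP n (restrict \<omega> {0..<n})) \<partial>PF.lim)"
    by (rule nn_integral_lim_restrict[symmetric]) measurable
  also have "\<dots> = (\<integral>\<^sup>+\<omega>. (\<integral>\<^sup>+q. h ((restrict \<omega> {0..<n})(n := q)) \<partial>P n (restrict \<omega> {0..<n})) \<partial>PF.lim)"
    by (intro nn_integral_cong nn_integral_eP h) (auto simp: space_PiM)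
  finally show ?thesis .
qed

end

section \<open>Measurability in a control model\<close>

text \<open>The stage cost, extended by zero to the pairs at which the path is frozen. Unlike \<open>cost M\<close>, it
  is measurable on the whole of \<open>pair_space M\<close>, and it makes the hitting time superfluous in the total
  cost.\<close>

definition live_cost :: "('x, 'a) model \<Rightarrow> 'x \<times> 'a \<Rightarrow> ennreal" where
  "live_cost M p = (if p \<in> live_pairs M then ennreal (cost M p) else 0)"

text \<open>A control model, without the regularity assumptions.\<close>

locale controlled =
  fixes M :: "('x::polish_space, 'a::polish_space) model"
  assumes model: "control_model M"
begin

lemma space_state_space [simp]: "space (state_space M) = states M"
  by (simp add: state_space_def space_restrict_space)

lemma space_action_space [simp]: "space (action_space M) = actions M"
  by (simp add: action_space_def space_restrict_space)

lemma space_live_space [simp]: "space (live_space M) = live M"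
  by (simp add: live_space_def space_restrict_space)

lemma space_pair_space: "space (pair_space M) = states M \<times> actions M"
  by (simp add: pair_space_def space_pair_measure)

lemma feasible_subset: "x \<in> states M \<Longrightarrow> feasible M x \<subseteq> actions M"
  using model sets.sets_into_space unfolding control_model_def by fastforce

lemma live_subset: "live M \<subseteq> states M"
  by (auto simp: live_def)

lemma live_pairs_subset: "live_pairs M \<subseteq> space (pair_space M)"
  using feasible_subset live_subset by (auto simp: live_pairs_def space_pair_space)

lemma measurable_target [measurable]: "target M \<in> sets (state_space M)"
  using model by (simp add: control_model_def)

lemma measurable_live [measurable]: "live M \<in> sets (state_space M)"
  using sets.compl_sets[OF measurable_target] by (simp add: live_def)

lemma measurable_fst_pair [measurable]: "fst \<in> pair_space M \<rightarrow>\<^sub>M state_space M"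
  by (simp add: pair_space_def)

lemma measurable_snd_pair [measurable]: "snd \<in> pair_space M \<rightarrow>\<^sub>M action_space M"
  by (simp add: pair_space_def)

lemma measurable_Pair_space [measurable (raw)]:
  "f \<in> N \<rightarrow>\<^sub>M state_space M \<Longrightarrow> g \<in> N \<rightarrow>\<^sub>M action_space M \<Longrightarrow> (\<lambda>x. (f x, g x)) \<in> N \<rightarrow>\<^sub>M pair_space M"
  by (simp add: pair_space_def)

lemma measurable_live_pairs [measurable]: "live_pairs M \<in> sets (pair_space M)"
proof -
  have "live_pairs M = feasible_pairs M \<inter> {p \<in> space (pair_space M). fst p \<in> live M}"
    using live_subset live_pairs_subset by (auto simp: live_pairs_def feasible_pairs_def)
  also have "\<dots> \<in> sets (pair_space M)"
  proof (rule sets.Int)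
    show "feasible_pairs M \<in> sets (pair_space M)" using model by (simp add: control_model_def)
  qed measurable
  finally show ?thesis .
qed

lemma measurable_law:
  "law M \<in> restrict_space (pair_space M) (live_pairs M) \<rightarrow>\<^sub>M prob_algebra (state_space M)"
proof (rule measurable_restrict_mono)
  show "law M \<in> restrict_space (pair_space M) (feasible_pairs M) \<rightarrow>\<^sub>M prob_algebra (state_space M)"
    using model by (simp add: control_model_def)
  show "live_pairs M \<subseteq> feasible_pairs M"
    using live_subset by (auto simp: live_pairs_def feasible_pairs_def)
qed

lemma law_in_prob_algebra: "p \<in> live_pairs M \<Longrightarrow> law M p \<in> space (prob_algebra (state_space M))"
  using measurable_space[OF measurable_law, of p] live_pairs_subset by (auto simp: space_restrict_space)

lemma sets_law: "p \<in> live_pairs M \<Longrightarrow> sets (law M p) = sets (state_space M)"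
  using law_in_prob_algebra by (simp add: space_prob_algebra)

lemma space_law: "p \<in> live_pairs M \<Longrightarrow> space (law M p) = states M"
  using sets_eq_imp_space_eq[OF sets_law] by simp

lemma prob_space_law: "p \<in> live_pairs M \<Longrightarrow> prob_space (law M p)"
  using law_in_prob_algebra by (simp add: space_prob_algebra)

lemma measurable_live_cost [measurable]: "live_cost M \<in> borel_measurable (pair_space M)"
proof -
  have "(\<lambda>p. ennreal (cost M p)) \<in> borel_measurable (restrict_space (pair_space M) (live_pairs M))"
    using model unfolding control_model_def by (intro measurable_compose[OF _ measurable_ennreal]) auto
  then show ?thesis
    unfolding live_cost_def[abs_def] by (subst measurable_If_restrict_space_iff) auto
qed

text \<open>Functions on \<open>live M\<close> are integrated after extension by zero to the whole state space.\<close>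

lemma measurable_live_space_iff:
  fixes v :: "'x \<Rightarrow> ennreal"
  shows "v \<in> borel_measurable (live_space M) \<longleftrightarrow> (\<lambda>y. v y * indicator (live M) y) \<in> borel_measurable (state_space M)"
proof -
  have "sets (live_space M) = sets (restrict_space (state_space M) (live M))"
    using live_subset by (simp add: live_space_def state_space_def sets_restrict_restrict_space Int_absorb1)
  then have "v \<in> borel_measurable (live_space M) \<longleftrightarrow>
      v \<in> borel_measurable (restrict_space (state_space M) (live M))"
    by (simp cong: measurable_cong_sets)
  also have "\<dots> \<longleftrightarrow> (\<lambda>y. v y * indicator (live M) y) \<in> borel_measurable (state_space M)"
    by (rule borel_measurable_restrict_space_iff_ennreal) (simp add: Int_absorb2 live_subset)
  finally show ?thesis .
qed

lemma measurable_into_live_space: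
  assumes f: "f \<in> N \<rightarrow>\<^sub>M state_space M" and "\<And>x. x \<in> space N \<Longrightarrow> f x \<in> live M"
  shows "f \<in> N \<rightarrow>\<^sub>M live_space M"
  unfolding live_space_def
  using assms measurable_restrict_space2_iff[of f N borel "states M"]
  by (intro measurable_restrict_space2) (auto simp: state_space_def)

lemma measurable_live_to_state: "(\<lambda>y. y) \<in> live_space M \<rightarrow>\<^sub>M state_space M"
  unfolding live_space_def state_space_def using live_subset
  by (intro measurable_restrict_space2 measurable_restrict_space1) (auto simp: space_restrict_space)

lemma measurable_integral_law:
  assumes v: "v \<in> borel_measurable (live_space M)"
  shows "(\<lambda>p. \<integral>\<^sup>+y\<in>live M. v y \<partial>law M p) \<in> borel_measurable (restrict_space (pair_space M) (live_pairs M))"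
  using v unfolding measurable_live_space_iff
  by (intro measurable_compose[OF measurable_prob_algebraD[OF measurable_law]]
        nn_integral_measurable_subprob_algebra)

lemma measurable_one_step_cost:
  assumes v: "v \<in> borel_measurable (live_space M)" and f: "f \<in> selectors M"
  shows "(\<lambda>x. one_step_cost M \<alpha> v x (f x)) \<in> borel_measurable (live_space M)"
proof -
  have [measurable]: "f \<in> live_space M \<rightarrow>\<^sub>M action_space M" using f by (simp add: selectors_def)
  note [measurable] = measurable_live_to_state
  have "(\<lambda>x. (x, f x)) \<in> live_space M \<rightarrow>\<^sub>M pair_space M" by measurable
  then have pair: "(\<lambda>x. (x, f x)) \<in> live_space M \<rightarrow>\<^sub>M restrict_space (pair_space M) (live_pairs M)"
    using f by (intro measurable_restrict_space2) (auto simp: selectors_def live_pairs_def)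
  have "cost M \<in> borel_measurable (restrict_space (pair_space M) (live_pairs M))"
    using model by (simp add: control_model_def)
  note [measurable] = measurable_compose[OF pair this]
    measurable_compose[OF pair measurable_integral_law[OF v]]
  show ?thesis unfolding one_step_cost_def by measurable
qed

section \<open>The transition kernel of the path\<close>

lemma policy_in_prob_algebra:
  "\<phi> \<in> policies M \<Longrightarrow> y \<in> live M \<Longrightarrow> \<phi> t y \<in> space (prob_algebra (action_space M))"
  by (rule measurable_space[of "\<phi> t" "live_space M"]) (simp_all add: policies_def)

lemma AE_feasible:
  assumes "\<phi> \<in> policies M" "y \<in> live M"
  shows "AE b in \<phi> t y. b \<in> feasible M y"
proof -
  have *: "prob_space (\<phi> t y)" "sets (\<phi> t y) = sets (action_space M)"
    using policy_in_prob_algebra[OF assms, of t] by (simp_all add: space_prob_algebra)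
  then interpret prob_space "\<phi> t y" by simp
  have "emeasure (\<phi> t y) (feasible M y) = 1"
    using assms by (simp add: policies_def)
  then have "prob (feasible M y) = 1"
    by (simp add: measure_def)
  then show ?thesis by (rule AE_prob_1)
qed

lemma stationary_in_policies:
  assumes f: "f \<in> selectors M"
  shows "stationary M f \<in> policies M"
proof -
  have "emeasure (return (action_space M) (f x)) (feasible M x) = 1" if "x \<in> live M" for x
  proof -
    have "x \<in> states M" using that live_subset by auto
    then have "feasible M x \<in> sets (action_space M)" using model by (simp add: control_model_def)
    moreover have "f x \<in> feasible M x" using f that by (simp add: selectors_def)
    ultimately show ?thesis by (simp add: emeasure_return)
  qed
  moreover have "(\<lambda>x. return (action_space M) (f x)) \<in> live_space M \<rightarrow>\<^sub>M prob_algebra (action_space M)"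
    using f by (intro measurable_compose[OF _ measurable_return_prob_space]) (simp add: selectors_def)
  ultimately show ?thesis
    unfolding policies_def stationary_def by blast
qed

text \<open>The law of the next pair, given the current pair \<open>p\<close> and the next state \<open>y\<close>. Policies are
  measurable only on \<open>live M\<close>, so measurability is checked separately on the two cases.\<close>

lemma measurable_next_pair:
  assumes \<phi>: "\<phi> \<in> policies M"
  shows "(\<lambda>(p, y). if y \<in> target M then return (pair_space M) (y, snd p)
            else distr (\<phi> t y) (pair_space M) (\<lambda>b. (y, b)))
     \<in> pair_space M \<Otimes>\<^sub>M state_space M \<rightarrow>\<^sub>M prob_algebra (pair_space M)"
proof -
  let ?R = "restrict_space (pair_space M \<Otimes>\<^sub>M state_space M) {z. \<not> snd z \<in> target M}"
  have 1: "(\<lambda>z. return (pair_space M) (snd z, snd (fst z)))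
      \<in> restrict_space (pair_space M \<Otimes>\<^sub>M state_space M) {z. snd z \<in> target M} \<rightarrow>\<^sub>M prob_algebra (pair_space M)"
    by (rule measurable_restrict_space1) measurable
  have [measurable]: "snd \<in> ?R \<rightarrow>\<^sub>M state_space M"
    by (rule measurable_restrict_space1) measurable
  have "snd \<in> ?R \<rightarrow>\<^sub>M live_space M"
    by (rule measurable_into_live_space) (auto simp: space_restrict_space space_pair_measure live_def)
  moreover have "\<phi> t \<in> live_space M \<rightarrow>\<^sub>M prob_algebra (action_space M)"
    using \<phi> by (simp add: policies_def)
  ultimately have [measurable]: "(\<lambda>z. \<phi> t (snd z)) \<in> ?R \<rightarrow>\<^sub>M prob_algebra (action_space M)"
    by (rule measurable_compose)
  have 2: "(\<lambda>z. distr (\<phi> t (snd z)) (pair_space M) (\<lambda>b. (snd z, b))) \<in> ?R \<rightarrow>\<^sub>M prob_algebra (pair_space M)"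
  proof (rule measurable_distr_prob_space2)
    have "(\<lambda>w. (snd (fst w), snd w)) \<in> ?R \<Otimes>\<^sub>M action_space M \<rightarrow>\<^sub>M pair_space M"
      by measurable
    then show "(\<lambda>(z, b). (snd z, b)) \<in> ?R \<Otimes>\<^sub>M action_space M \<rightarrow>\<^sub>M pair_space M"
      by (simp only: split_beta')
  qed fact
  have cond: "{z \<in> space (pair_space M \<Otimes>\<^sub>M state_space M). snd z \<in> target M} \<in> sets (pair_space M \<Otimes>\<^sub>M state_space M)"
    by measurable
  show ?thesis
    unfolding split_beta' by (rule measurable_If_restrict_space_iff[OF cond, THEN iffD2, OF conjI[OF 1 2]])
qed

lemma measurable_transition:
  assumes \<phi>: "\<phi> \<in> policies M"
  shows "transition M \<phi> t \<in> pair_space M \<rightarrow>\<^sub>M prob_algebra (pair_space M)"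
proof -
  let ?R = "restrict_space (pair_space M) (live_pairs M)"
  note [measurable] = measurable_next_pair[OF \<phi>, of t] measurable_law
  have id: "(\<lambda>p. p) \<in> ?R \<rightarrow>\<^sub>M pair_space M"
    by (rule measurable_restrict_space1) simp
  have lift: "(\<lambda>z. (fst z, snd z)) \<in> ?R \<Otimes>\<^sub>M state_space M \<rightarrow>\<^sub>M pair_space M \<Otimes>\<^sub>M state_space M"
    by (intro measurable_Pair measurable_compose[OF measurable_fst id] measurable_snd)
  have "(\<lambda>(p, y). if y \<in> target M then return (pair_space M) (y, snd p)
            else distr (\<phi> t y) (pair_space M) (\<lambda>b. (y, b)))
     \<in> ?R \<Otimes>\<^sub>M state_space M \<rightarrow>\<^sub>M prob_algebra (pair_space M)"
    using measurable_compose[OF lift measurable_next_pair[OF \<phi>, of t]] by (simp only: prod.collapse)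
  note live = measurable_bind_prob_space2[OF measurable_law this]
  have frozen: "return (pair_space M) \<in> restrict_space (pair_space M) {p. p \<notin> live_pairs M} \<rightarrow>\<^sub>M prob_algebra (pair_space M)"
    by (intro measurable_restrict_space1 measurable_return_prob_space)
  have cond: "{p \<in> space (pair_space M). p \<in> live_pairs M} \<in> sets (pair_space M)" by measurable
  show ?thesis
    unfolding transition_def[abs_def]
    by (rule measurable_If_restrict_space_iff[OF cond, THEN iffD2])
      (use live frozen in \<open>simp only: Collect_mem_eq prod.case\<close>)
qed

lemma nn_integral_transition:
  assumes \<phi>: "\<phi> \<in> policies M" and p: "p \<in> live_pairs M" and h[measurable]: "h \<in> borel_measurable (pair_space M)"
  shows "(\<integral>\<^sup>+q. h q \<partial>transition M \<phi> t p) =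
    (\<integral>\<^sup>+y. (if y \<in> target M then h (y, snd p) else \<integral>\<^sup>+b. h (y, b) \<partial>\<phi> t y) \<partial>law M p)"
proof -
  have p': "p \<in> space (pair_space M)" using p live_pairs_subset by auto
  let ?k = "\<lambda>y. if y \<in> target M then return (pair_space M) (y, snd p) else distr (\<phi> t y) (pair_space M) (\<lambda>b. (y, b))"
  have "?k \<in> state_space M \<rightarrow>\<^sub>M subprob_algebra (pair_space M)"
    using measurable_compose[OF measurable_Pair1'[OF p'] measurable_prob_algebraD[OF measurable_next_pair[OF \<phi>, of t]]]
    by simp
  then have k: "?k \<in> law M p \<rightarrow>\<^sub>M subprob_algebra (pair_space M)"
    by (simp add: measurable_cong_sets[OF sets_law[OF p] refl])
  have "(\<integral>\<^sup>+q. h q \<partial>transition M \<phi> t p) = (\<integral>\<^sup>+y. \<integral>\<^sup>+q. h q \<partial>?k y \<partial>law M p)"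
    using p unfolding transition_def by (simp add: nn_integral_bind[OF h k])
  also have "\<dots> = (\<integral>\<^sup>+y. (if y \<in> target M then h (y, snd p) else \<integral>\<^sup>+b. h (y, b) \<partial>\<phi> t y) \<partial>law M p)"
  proof (rule nn_integral_cong)
    fix y assume "y \<in> space (law M p)"
    then have y: "y \<in> states M" using space_law[OF p] by simp
    show "(\<integral>\<^sup>+q. h q \<partial>?k y) = (if y \<in> target M then h (y, snd p) else \<integral>\<^sup>+b. h (y, b) \<partial>\<phi> t y)"
    proof (cases "y \<in> target M")
      case True
      with p' y show ?thesis by (auto simp: nn_integral_return space_pair_space)
    next
      case False
      with y have "y \<in> live M" by (simp add: live_def)
      then have s: "sets (\<phi> t y) = sets (action_space M)"
        using policy_in_prob_algebra[OF \<phi>] by (simp add: space_prob_algebra)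
      have "(\<lambda>b. (y, b)) \<in> \<phi> t y \<rightarrow>\<^sub>M pair_space M"
        using y by (simp add: measurable_cong_sets[OF s refl] pair_space_def)
      with False show ?thesis by (simp add: nn_integral_distr)
    qed
  qed
  finally show ?thesis .
qed

text \<open>A function that vanishes at the frozen pairs only sees the transitions into \<open>live M\<close>.\<close>

lemma nn_integral_transition_live:
  assumes \<phi>: "\<phi> \<in> policies M" and p: "p \<in> live_pairs M" and h: "h \<in> borel_measurable (pair_space M)"
    and 0: "\<And>q. q \<notin> live_pairs M \<Longrightarrow> h q = 0"
  shows "(\<integral>\<^sup>+q. h q \<partial>transition M \<phi> t p) = (\<integral>\<^sup>+y\<in>live M. (\<integral>\<^sup>+b. h (y, b) \<partial>\<phi> t y) \<partial>law M p)"
  unfolding nn_integral_transition[OF \<phi> p h]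
proof (rule nn_integral_cong)
  fix y assume "y \<in> space (law M p)"
  then have "y \<in> live M \<longleftrightarrow> y \<notin> target M" by (simp add: space_law[OF p] live_def)
  moreover have "h (y, snd p) = 0" if "y \<in> target M"
    using that by (intro 0) (simp add: live_pairs_def live_def)
  ultimately show "(if y \<in> target M then h (y, snd p) else \<integral>\<^sup>+b. h (y, b) \<partial>\<phi> t y) =
      (\<integral>\<^sup>+b. h (y, b) \<partial>\<phi> t y) * indicator (live M) y"
    by simp
qed

lemma nn_integral_transition_frozen:
  assumes "p \<in> space (pair_space M)" "p \<notin> live_pairs M" "h \<in> borel_measurable (pair_space M)"
  shows "(\<integral>\<^sup>+q. h q \<partial>transition M \<phi> t p) = h p"
  using assms by (simp add: transition_def nn_integral_return)

section \<open>The path law and the expected total cost\<close>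

context
  fixes \<phi> x
  assumes \<phi>: "\<phi> \<in> policies M" and x: "x \<in> live M"
begin

lemma Ionescu_Tulcea_path_kernel: "Ionescu_Tulcea (path_kernel M \<phi> x) (\<lambda>_. pair_space M)"
proof -
  have "path_kernel M \<phi> x i \<in> PiM {0..<i} (\<lambda>_. pair_space M) \<rightarrow>\<^sub>M prob_algebra (pair_space M)" for i
  proof (cases i)
    case 0
    have "distr (\<phi> 0 x) (pair_space M) (\<lambda>b. (x, b)) \<in> space (prob_algebra (pair_space M))"
    proof (rule measurable_space[OF measurable_distr_prob_space policy_in_prob_algebra[OF \<phi> x]])
      show "(\<lambda>b. (x, b)) \<in> action_space M \<rightarrow>\<^sub>M pair_space M"
        using x live_subset unfolding pair_space_def by (intro measurable_Pair1') auto
    qed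
    then show ?thesis unfolding 0 path_kernel.simps by (rule measurable_const)
  next
    case (Suc t)
    show ?thesis unfolding Suc path_kernel.simps
      by (rule measurable_compose[OF measurable_component_singleton[of t "{0..<Suc t}" "\<lambda>_. pair_space M"]
            measurable_transition[OF \<phi>]]) simp
  qed
  note * = this
  show ?thesis
  proof (rule Ionescu_Tulcea.intro)
    show "path_kernel M \<phi> x i \<in> PiM {0..<i} (\<lambda>_. pair_space M) \<rightarrow>\<^sub>M subprob_algebra (pair_space M)" for i
      by (rule measurable_prob_algebraD[OF *])
    show "prob_space (path_kernel M \<phi> x i \<omega>)" if "\<omega> \<in> space (PiM {0..<i} (\<lambda>_. pair_space M))" for i \<omega>
      using measurable_space[OF * that] by (simp add: space_prob_algebra)
  qed
qed

interpretation IT: Ionescu_Tulcea "path_kernel M \<phi> x" "\<lambda>_. pair_space M"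
  by (rule Ionescu_Tulcea_path_kernel)

lemma path_law_eq: "path_law M \<phi> x = IT.PF.lim"
  by (simp add: path_law_def)

lemma sets_path_law [measurable_cong]: "sets (path_law M \<phi> x) = sets (PiM UNIV (\<lambda>_. pair_space M))"
  by (simp add: path_law_eq)

lemma space_path_law: "\<omega> \<in> space (path_law M \<phi> x) \<Longrightarrow> \<omega> i \<in> space (pair_space M)"
  using sets_eq_imp_space_eq[OF sets_path_law] by (auto simp: space_PiM)

lemma nn_integral_path_0:
  assumes h[measurable]: "h \<in> borel_measurable (pair_space M)"
  shows "(\<integral>\<^sup>+\<omega>. h (\<omega> 0) \<partial>path_law M \<phi> x) = (\<integral>\<^sup>+b. h (x, b) \<partial>\<phi> 0 x)"
proof -
  have s: "sets (\<phi> 0 x) = sets (action_space M)"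
    using policy_in_prob_algebra[OF \<phi> x] by (simp add: space_prob_algebra)
  have m: "(\<lambda>b. (x, b)) \<in> \<phi> 0 x \<rightarrow>\<^sub>M pair_space M"
    using x live_subset by (auto simp: measurable_cong_sets[OF s refl] pair_space_def)
  have "(\<lambda>\<omega>. \<omega> 0) \<in> PiM {0..<Suc 0} (\<lambda>_. pair_space M) \<rightarrow>\<^sub>M pair_space M" by measurable
  then have "(\<lambda>\<omega>. h (\<omega> 0)) \<in> borel_measurable (PiM {0..<Suc 0} (\<lambda>_. pair_space M))" by measurable
  from IT.nn_integral_lim_Suc[OF this]
  have "(\<integral>\<^sup>+\<omega>. h (\<omega> 0) \<partial>IT.PF.lim) = (\<integral>\<^sup>+\<omega>. (\<integral>\<^sup>+q. h q \<partial>path_kernel M \<phi> x 0 \<omega>) \<partial>IT.PF.lim)"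
    by simp
  also have "\<dots> = (\<integral>\<^sup>+\<omega>. (\<integral>\<^sup>+b. h (x, b) \<partial>\<phi> 0 x) \<partial>IT.PF.lim)"
    by (simp add: nn_integral_distr[OF m])
  also have "\<dots> = (\<integral>\<^sup>+b. h (x, b) \<partial>\<phi> 0 x)"
    using IT.nn_integral_lim_restrict[of "\<lambda>_. \<integral>\<^sup>+b. h (x, b) \<partial>\<phi> 0 x" 0]
    by simp
  finally show ?thesis by (simp add: path_law_eq)
qed

lemma nn_integral_path_Suc:
  assumes h[measurable]: "case_prod h \<in> borel_measurable (pair_space M \<Otimes>\<^sub>M pair_space M)"
  shows "(\<integral>\<^sup>+\<omega>. h (\<omega> i) (\<omega> (Suc i)) \<partial>path_law M \<phi> x) =
    (\<integral>\<^sup>+\<omega>. (\<integral>\<^sup>+q. h (\<omega> i) q \<partial>transition M \<phi> (Suc i) (\<omega> i)) \<partial>path_law M \<phi> x)"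
proof -
  have "(\<lambda>\<omega>. (\<omega> i, \<omega> (Suc i))) \<in> PiM {0..<Suc (Suc i)} (\<lambda>_. pair_space M) \<rightarrow>\<^sub>M pair_space M \<Otimes>\<^sub>M pair_space M"
    by measurable
  from measurable_compose[OF this h]
  have "(\<lambda>\<omega>. h (\<omega> i) (\<omega> (Suc i))) \<in> borel_measurable (PiM {0..<Suc (Suc i)} (\<lambda>_. pair_space M))" by simp
  from IT.nn_integral_lim_Suc[OF this] show ?thesis
    by (simp add: path_law_eq)
qed

lemma AE_live_or_target:
  "AE \<omega> in path_law M \<phi> x. \<omega> i \<in> live_pairs M \<or> fst (\<omega> i) \<in> target M"
proof -
  \<comment> \<open>Infeasible pairs outside \<open>target M\<close> have probability zero at time \<open>0\<close>, and this propagates.\<close>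
  define bad where "bad = {p \<in> space (pair_space M). p \<notin> live_pairs M \<and> fst p \<notin> target M}"
  have bad[measurable]: "bad \<in> sets (pair_space M)" unfolding bad_def by measurable
  have act0: "(\<integral>\<^sup>+b. indicator bad (y, b) \<partial>\<phi> t y) = 0" if y: "y \<in> live M" for t y
  proof -
    have "(\<integral>\<^sup>+b. indicator bad (y, b) \<partial>\<phi> t y) = (\<integral>\<^sup>+b. 0 \<partial>\<phi> t y)"
      using AE_feasible[OF \<phi> y, of t]
      by (intro nn_integral_cong_AE, elim AE_mp)
         (use y in \<open>auto simp: bad_def live_pairs_def split: split_indicator intro!: AE_I2\<close>)
    then show ?thesis by simp
  qed
  have "(\<integral>\<^sup>+\<omega>. indicator bad (\<omega> i) \<partial>path_law M \<phi> x) = 0"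
  proof (induction i)
    case 0
    show ?case by (subst nn_integral_path_0) (auto simp: act0[OF x])
  next
    case (Suc i)
    have "(\<integral>\<^sup>+\<omega>. indicator bad (\<omega> (Suc i)) \<partial>path_law M \<phi> x)
        = (\<integral>\<^sup>+\<omega>. (\<integral>\<^sup>+q. indicator bad q \<partial>transition M \<phi> (Suc i) (\<omega> i)) \<partial>path_law M \<phi> x)"
      by (rule nn_integral_path_Suc[of "\<lambda>_. indicator bad"]) measurable
    also have "\<dots> \<le> (\<integral>\<^sup>+\<omega>. indicator bad (\<omega> i) \<partial>path_law M \<phi> x)"
    proof (rule nn_integral_mono)
      fix \<omega> assume \<omega>: "\<omega> \<in> space (path_law M \<phi> x)"
      show "(\<integral>\<^sup>+q. indicator bad q \<partial>transition M \<phi> (Suc i) (\<omega> i)) \<le> (indicator bad (\<omega> i) :: ennreal)"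
      proof (cases "\<omega> i \<in> live_pairs M")
        case True
        have "(\<integral>\<^sup>+q. indicator bad q \<partial>transition M \<phi> (Suc i) (\<omega> i)) = (\<integral>\<^sup>+y. 0 \<partial>law M (\<omega> i))"
          unfolding nn_integral_transition[OF \<phi> True borel_measurable_indicator[OF bad]]
          by (rule nn_integral_cong) (auto simp: space_law[OF True] act0 live_def, auto simp: bad_def)
        then show ?thesis by simp
      next
        case False
        then show ?thesis
          using nn_integral_transition_frozen[OF space_path_law[OF \<omega>] False borel_measurable_indicator[OF bad]]
          by simp
      qed
    qed
    finally show ?case using Suc by simp
  qed
  then have "AE \<omega> in path_law M \<phi> x. indicator bad (\<omega> i) = (0::ennreal)"
    by (subst (asm) nn_integral_0_iff_AE) auto
  then show ?thesis
    using space_path_law by (elim AE_mp) (auto intro!: AE_I2 simp: bad_def split: split_indicator_asm)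
qed

text \<open>The set \<open>target M\<close> need not be absorbing for the transition law; it is absorbing for the path,
  which is frozen there.\<close>

lemma AE_target_absorbing:
  "AE \<omega> in path_law M \<phi> x. fst (\<omega> i) \<in> target M \<longrightarrow> fst (\<omega> (Suc i)) \<in> target M"
proof -
  \<comment> \<open>\<open>h (\<omega> i) (\<omega> (Suc i))\<close> is the indicator of the event that the path leaves \<open>target M\<close>.\<close>
  define h :: "'x \<times> 'a \<Rightarrow> 'x \<times> 'a \<Rightarrow> ennreal" where
    "h p q = (if fst p \<in> target M \<and> fst q \<notin> target M then 1 else 0)" for p q
  have h[measurable]: "case_prod h \<in> borel_measurable (pair_space M \<Otimes>\<^sub>M pair_space M)"
    unfolding h_def[abs_def] by measurable
  have "(\<integral>\<^sup>+\<omega>. h (\<omega> i) (\<omega> (Suc i)) \<partial>path_law M \<phi> x) = (\<integral>\<^sup>+\<omega>. 0 \<partial>path_law M \<phi> x)"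
    unfolding nn_integral_path_Suc[OF h]
  proof (rule nn_integral_cong)
    fix \<omega> assume \<omega>: "\<omega> \<in> space (path_law M \<phi> x)"
    note p = space_path_law[OF \<omega>, of i]
    show "(\<integral>\<^sup>+q. h (\<omega> i) q \<partial>transition M \<phi> (Suc i) (\<omega> i)) = 0"
    proof (cases "fst (\<omega> i) \<in> target M")
      case True
      then have "\<omega> i \<notin> live_pairs M" by (auto simp: live_pairs_def live_def)
      moreover have "h (\<omega> i) \<in> borel_measurable (pair_space M)"
        using measurable_compose[OF measurable_Pair1'[OF p] h] by simp
      ultimately show ?thesis
        using nn_integral_transition_frozen[OF p, of "h (\<omega> i)"] by (simp add: h_def)
    qed (simp add: h_def)
  qed
  then have "(\<integral>\<^sup>+\<omega>. h (\<omega> i) (\<omega> (Suc i)) \<partial>path_law M \<phi> x) = 0" by simp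
  then have "AE \<omega> in path_law M \<phi> x. h (\<omega> i) (\<omega> (Suc i)) = 0"
    by (subst (asm) nn_integral_0_iff_AE) auto
  then show ?thesis
    by (rule AE_mp) (auto intro!: AE_I2 simp: h_def split: if_splits)
qed

text \<open>Almost surely, the times before the hitting time are exactly the times at which the path is at a
  live pair, so the total cost is the discounted sum of \<open>live_cost\<close>.\<close>

lemma policy_value_eq:
  assumes \<alpha>: "0 < \<alpha>"
  shows "policy_value M \<alpha> \<phi> x = (\<Sum>i. ennreal (\<alpha> ^ i) * (\<integral>\<^sup>+\<omega>. live_cost M (\<omega> i) \<partial>path_law M \<phi> x))"
proof -
  have "AE \<omega> in path_law M \<phi> x. (\<forall>i. \<omega> i \<in> live_pairs M \<or> fst (\<omega> i) \<in> target M)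
      \<and> (\<forall>i. fst (\<omega> i) \<in> target M \<longrightarrow> fst (\<omega> (Suc i)) \<in> target M)"
    using AE_live_or_target AE_target_absorbing by (auto simp: AE_all_countable)
  then have "AE \<omega> in path_law M \<phi> x. total_cost M \<alpha> \<omega> = (\<Sum>i. ennreal (\<alpha> ^ i) * live_cost M (\<omega> i))"
  proof (elim AE_mp, intro AE_I2 impI)
    fix \<omega> assume "(\<forall>i. \<omega> i \<in> live_pairs M \<or> fst (\<omega> i) \<in> target M)
      \<and> (\<forall>i. fst (\<omega> i) \<in> target M \<longrightarrow> fst (\<omega> (Suc i)) \<in> target M)"
    then have 1: "\<And>i. \<omega> i \<in> live_pairs M \<or> fst (\<omega> i) \<in> target M"
      and 2: "\<And>i. fst (\<omega> i) \<in> target M \<Longrightarrow> fst (\<omega> (Suc i)) \<in> target M" by auto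
    have 3: "fst (\<omega> j) \<in> target M" if "i \<le> j" "fst (\<omega> i) \<in> target M" for i j
      using that by (induction rule: dec_induct) (auto intro: 2)
    have "enat i < hitting_time M \<omega> \<longleftrightarrow> \<omega> i \<in> live_pairs M" for i
    proof -
      have "enat i < hitting_time M \<omega> \<longleftrightarrow> (\<forall>j. fst (\<omega> j) \<in> target M \<longrightarrow> i < j)"
      proof
        assume "enat i < hitting_time M \<omega>"
        then show "\<forall>j. fst (\<omega> j) \<in> target M \<longrightarrow> i < j"
          unfolding hitting_time_def by (auto dest!: less_INF_D)
      next
        assume *: "\<forall>j. fst (\<omega> j) \<in> target M \<longrightarrow> i < j"
        have "enat (Suc i) \<le> hitting_time M \<omega>"
          unfolding hitting_time_def by (rule INF_greatest) (use * in auto)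
        moreover have "enat i < enat (Suc i)" by simp
        ultimately show "enat i < hitting_time M \<omega>" by (rule less_le_trans[rotated])
      qed
      also have "\<dots> \<longleftrightarrow> fst (\<omega> i) \<notin> target M" using 3 not_le by blast
      also have "\<dots> \<longleftrightarrow> \<omega> i \<in> live_pairs M"
        using 1[of i] by (auto simp: live_pairs_def live_def)
      finally show ?thesis .
    qed
    then show "total_cost M \<alpha> \<omega> = (\<Sum>i. ennreal (\<alpha> ^ i) * live_cost M (\<omega> i))"
      unfolding total_cost_def using \<alpha>
      by (intro suminf_cong) (auto simp: live_cost_def ennreal_mult')
  qed
  then have "policy_value M \<alpha> \<phi> x = (\<integral>\<^sup>+\<omega>. (\<Sum>i. ennreal (\<alpha> ^ i) * live_cost M (\<omega> i)) \<partial>path_law M \<phi> x)"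
    unfolding policy_value_def by (rule nn_integral_cong_AE)
  also have "\<dots> = (\<Sum>i. ennreal (\<alpha> ^ i) * (\<integral>\<^sup>+\<omega>. live_cost M (\<omega> i) \<partial>path_law M \<phi> x))"
    by (subst nn_integral_suminf) (auto simp: nn_integral_cmult)
  finally show ?thesis .
qed

end

end

section \<open>Bounds for policy values by value iteration\<close>

lemma one_step_cost_mono:
  "u \<le> v \<Longrightarrow> one_step_cost M \<alpha> u x a \<le> one_step_cost M \<alpha> v x a"
  unfolding one_step_cost_def
  by (intro add_left_mono mult_left_mono nn_integral_mono mult_right_mono) (auto simp: le_fun_def)

lemma incseq_value_iteration: "incseq (value_iteration M \<alpha>)"
proof (rule incseq_SucI)
  show "value_iteration M \<alpha> n \<le> value_iteration M \<alpha> (Suc n)" for n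
  proof (induction n)
    case (Suc n)
    then show ?case
      by (auto simp: le_fun_def simp del: value_iteration.simps(1)
          intro!: INF_mono' one_step_cost_mono)
  qed (simp add: le_fun_def)
qed

context controlled
begin

lemma one_step_cost_eq:
  "p \<in> live_pairs M \<Longrightarrow>
   one_step_cost M \<alpha> v (fst p) (snd p) = live_cost M p + ennreal \<alpha> * (\<integral>\<^sup>+y\<in>live M. v y \<partial>law M p)"
  by (simp add: one_step_cost_def live_cost_def)

text \<open>The optimal cost over \<open>n\<close> stages is a lower bound for the cost of every policy. With \<open>W n p\<close> the
  value \<open>v\<^sub>n\<close> at the state of a live pair \<open>p\<close>, one has \<open>W (n + 1) \<le> live_cost + \<alpha> (transition) W n\<close>
  pointwise; this is iterated along the path.\<close>

lemma policy_value_ge_value_iteration: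
  assumes \<alpha>: "0 < \<alpha>" and v: "\<And>n. value_iteration M \<alpha> n \<in> borel_measurable (live_space M)"
    and \<phi>: "\<phi> \<in> policies M" and x: "x \<in> live M"
  shows "value_iteration M \<alpha> n x \<le> policy_value M \<alpha> \<phi> x"
proof -
  define W where "W n p = (if p \<in> live_pairs M then value_iteration M \<alpha> n (fst p) else 0)" for n p
  define c where "c i = (\<integral>\<^sup>+\<omega>. live_cost M (\<omega> i) \<partial>path_law M \<phi> x)" for i
  have W[measurable]: "W n \<in> borel_measurable (pair_space M)" for n
  proof -
    have "(\<lambda>p. value_iteration M \<alpha> n (fst p) * indicator (live M) (fst p)) \<in> borel_measurable (pair_space M)"
      using v[of n] unfolding measurable_live_space_iff by measurable
    then have "(\<lambda>p. if p \<in> live_pairs M then value_iteration M \<alpha> n (fst p) * indicator (live M) (fst p) else 0)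
        \<in> borel_measurable (pair_space M)" by measurable
    also have "(\<lambda>p. if p \<in> live_pairs M then value_iteration M \<alpha> n (fst p) * indicator (live M) (fst p) else 0) = W n"
      by (auto simp: W_def live_pairs_def fun_eq_iff)
    finally show ?thesis .
  qed
  have act: "(\<integral>\<^sup>+b. W n (y, b) \<partial>\<phi> t y) = value_iteration M \<alpha> n y" if y: "y \<in> live M" for n t y
  proof -
    interpret prob_space "\<phi> t y"
      using policy_in_prob_algebra[OF \<phi> y] by (simp add: space_prob_algebra)
    have "(\<integral>\<^sup>+b. W n (y, b) \<partial>\<phi> t y) = (\<integral>\<^sup>+b. value_iteration M \<alpha> n y \<partial>\<phi> t y)"
      using AE_feasible[OF \<phi> y, of t]
      by (intro nn_integral_cong_AE, elim AE_mp)
         (use y in \<open>auto simp: W_def live_pairs_def intro!: AE_I2\<close>)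
    then show ?thesis by (simp add: emeasure_space_1)
  qed
  have step: "W (Suc n) p \<le> live_cost M p + ennreal \<alpha> * (\<integral>\<^sup>+q. W n q \<partial>transition M \<phi> t p)" for n p t
  proof (cases "p \<in> live_pairs M")
    case True
    have "(\<integral>\<^sup>+q. W n q \<partial>transition M \<phi> t p) = (\<integral>\<^sup>+y\<in>live M. value_iteration M \<alpha> n y \<partial>law M p)"
      by (subst nn_integral_transition_live[OF \<phi> True W])
         (auto simp: W_def[abs_def] act[unfolded W_def] intro!: nn_integral_cong split: split_indicator)
    moreover have "W (Suc n) p \<le> one_step_cost M \<alpha> (value_iteration M \<alpha> n) (fst p) (snd p)"
      using True by (auto simp: W_def live_pairs_def intro!: INF_lower)
    ultimately show ?thesis by (simp add: one_step_cost_eq[OF True])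
  qed (simp add: W_def)
  have bound: "(\<integral>\<^sup>+\<omega>. W n (\<omega> i) \<partial>path_law M \<phi> x) \<le> (\<Sum>k<n. ennreal \<alpha> ^ k * c (i + k))" for n i
  proof (induction n arbitrary: i)
    case 0
    have "W 0 = (\<lambda>_. 0)" by (auto simp: W_def fun_eq_iff)
    then show ?case by simp
  next
    case (Suc n)
    note [measurable_cong] = sets_path_law[OF \<phi> x]
    have [measurable]: "(\<lambda>p. \<integral>\<^sup>+q. W n q \<partial>transition M \<phi> (Suc i) p) \<in> borel_measurable (pair_space M)"
      by (rule measurable_compose[OF measurable_prob_algebraD[OF measurable_transition[OF \<phi>]]
            nn_integral_measurable_subprob_algebra[OF W]])
    have "(\<integral>\<^sup>+\<omega>. W (Suc n) (\<omega> i) \<partial>path_law M \<phi> x)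
        \<le> (\<integral>\<^sup>+\<omega>. live_cost M (\<omega> i) + ennreal \<alpha> * (\<integral>\<^sup>+q. W n q \<partial>transition M \<phi> (Suc i) (\<omega> i)) \<partial>path_law M \<phi> x)"
      by (intro nn_integral_mono step)
    also have "\<dots> = c i + ennreal \<alpha> * (\<integral>\<^sup>+\<omega>. (\<integral>\<^sup>+q. W n q \<partial>transition M \<phi> (Suc i) (\<omega> i)) \<partial>path_law M \<phi> x)"
      unfolding c_def by (subst nn_integral_add) (auto simp: nn_integral_cmult)
    also have "(\<integral>\<^sup>+\<omega>. (\<integral>\<^sup>+q. W n q \<partial>transition M \<phi> (Suc i) (\<omega> i)) \<partial>path_law M \<phi> x)
        = (\<integral>\<^sup>+\<omega>. W n (\<omega> (Suc i)) \<partial>path_law M \<phi> x)"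
      by (rule nn_integral_path_Suc[OF \<phi> x, of "\<lambda>_. W n", symmetric]) measurable
    also have "c i + ennreal \<alpha> * \<dots> \<le> c i + ennreal \<alpha> * (\<Sum>k<n. ennreal \<alpha> ^ k * c (Suc i + k))"
      by (intro add_left_mono mult_left_mono Suc) auto
    also have "\<dots> = (\<Sum>k<Suc n. ennreal \<alpha> ^ k * c (i + k))"
      by (subst sum.lessThan_Suc_shift) (simp add: sum_distrib_left mult.assoc)
    finally show ?case .
  qed
  have "value_iteration M \<alpha> n x = (\<integral>\<^sup>+\<omega>. W n (\<omega> 0) \<partial>path_law M \<phi> x)"
    by (simp add: nn_integral_path_0[OF \<phi> x W] act[OF x])
  also have "\<dots> \<le> (\<Sum>k<n. ennreal \<alpha> ^ k * c k)"
    using bound[of n 0] by simp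
  also have "\<dots> \<le> (\<Sum>k. ennreal \<alpha> ^ k * c k)"
    by (rule sum_le_suminf) auto
  also have "\<dots> = policy_value M \<alpha> \<phi> x"
    using \<alpha> by (simp add: policy_value_eq[OF \<phi> x] c_def ennreal_power)
  finally show ?thesis .
qed

text \<open>A function that dominates its one-step cost under \<open>f\<close> dominates the cost of the stationary
  policy \<open>f\<close>. The argument uses \<open>U p\<close>, the one-step cost at the pair \<open>p\<close>, in place of the value at the
  state of \<open>p\<close>: the inequality \<open>live_cost + \<alpha> (transition) U \<le> U\<close> then holds at every pair, not only at
  the pairs \<open>(y, f y)\<close>.\<close>

lemma policy_value_stationary_le:
  assumes \<alpha>: "0 < \<alpha>" and v: "v \<in> borel_measurable (live_space M)"
    and f: "f \<in> selectors M" and le: "\<And>y. y \<in> live M \<Longrightarrow> one_step_cost M \<alpha> v y (f y) \<le> v y"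
    and x: "x \<in> live M"
  shows "policy_value M \<alpha> (stationary M f) x \<le> v x"
proof -
  let ?\<phi> = "stationary M f"
  note \<phi> = stationary_in_policies[OF f]
  define U where "U p = (if p \<in> live_pairs M then one_step_cost M \<alpha> v (fst p) (snd p) else 0)" for p
  define c where "c i = (\<integral>\<^sup>+\<omega>. live_cost M (\<omega> i) \<partial>path_law M ?\<phi> x)" for i
  have U[measurable]: "U \<in> borel_measurable (pair_space M)"
  proof -
    have "(\<lambda>p. live_cost M p + ennreal \<alpha> * (\<integral>\<^sup>+y\<in>live M. v y \<partial>law M p))
        \<in> borel_measurable (restrict_space (pair_space M) (live_pairs M))"
      using measurable_integral_law[OF v] measurable_restrict_space1[OF measurable_live_cost] by measurable
    then have "(\<lambda>p. if p \<in> live_pairs M then live_cost M p + ennreal \<alpha> * (\<integral>\<^sup>+y\<in>live M. v y \<partial>law M p) else 0)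
        \<in> borel_measurable (pair_space M)"
      by (subst measurable_If_restrict_space_iff) auto
    also have "(\<lambda>p. if p \<in> live_pairs M then live_cost M p + ennreal \<alpha> * (\<integral>\<^sup>+y\<in>live M. v y \<partial>law M p) else 0) = U"
      by (rule ext) (simp add: U_def one_step_cost_eq)
    finally show ?thesis .
  qed
  have act: "(\<integral>\<^sup>+b. U (y, b) \<partial>?\<phi> t y) \<le> v y" if y: "y \<in> live M" for y t
  proof -
    have fy: "f y \<in> feasible M y" "f y \<in> actions M"
      using f y feasible_subset live_subset by (auto simp: selectors_def)
    have "(\<lambda>b. U (y, b)) \<in> borel_measurable (action_space M)"
      using y live_subset by (intro measurable_compose[OF measurable_Pair1' U[unfolded pair_space_def]]) auto
    then have "(\<integral>\<^sup>+b. U (y, b) \<partial>?\<phi> t y) = U (y, f y)"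
      using fy by (simp add: stationary_def nn_integral_return)
    also have "\<dots> \<le> v y" using le[OF y] y fy by (simp add: U_def live_pairs_def)
    finally show ?thesis .
  qed
  have step: "live_cost M p + ennreal \<alpha> * (\<integral>\<^sup>+q. U q \<partial>transition M ?\<phi> t p) \<le> U p"
    if p: "p \<in> space (pair_space M)" for p t
  proof (cases "p \<in> live_pairs M")
    case True
    have "(\<integral>\<^sup>+q. U q \<partial>transition M ?\<phi> t p) \<le> (\<integral>\<^sup>+y\<in>live M. v y \<partial>law M p)"
      by (subst nn_integral_transition_live[OF \<phi> True U])
         (auto simp: U_def[abs_def] act[unfolded U_def] intro!: nn_integral_mono split: split_indicator)
    then show ?thesis
      using True by (simp add: U_def one_step_cost_eq[OF True] add_left_mono mult_left_mono)
  next
    case False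
    then show ?thesis
      using nn_integral_transition_frozen[OF p False U] by (simp add: U_def live_cost_def)
  qed
  have bound: "(\<Sum>k<n. ennreal \<alpha> ^ k * c (i + k)) \<le> (\<integral>\<^sup>+\<omega>. U (\<omega> i) \<partial>path_law M ?\<phi> x)" for n i
  proof (induction n arbitrary: i)
    case (Suc n)
    note [measurable_cong] = sets_path_law[OF \<phi> x]
    have [measurable]: "(\<lambda>p. \<integral>\<^sup>+q. U q \<partial>transition M ?\<phi> (Suc i) p) \<in> borel_measurable (pair_space M)"
      by (rule measurable_compose[OF measurable_prob_algebraD[OF measurable_transition[OF \<phi>]]
            nn_integral_measurable_subprob_algebra[OF U]])
    have "(\<Sum>k<Suc n. ennreal \<alpha> ^ k * c (i + k)) = c i + ennreal \<alpha> * (\<Sum>k<n. ennreal \<alpha> ^ k * c (Suc i + k))"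
      by (subst sum.lessThan_Suc_shift) (simp add: sum_distrib_left mult.assoc)
    also have "\<dots> \<le> c i + ennreal \<alpha> * (\<integral>\<^sup>+\<omega>. U (\<omega> (Suc i)) \<partial>path_law M ?\<phi> x)"
      by (intro add_left_mono mult_left_mono Suc) auto
    also have "(\<integral>\<^sup>+\<omega>. U (\<omega> (Suc i)) \<partial>path_law M ?\<phi> x)
        = (\<integral>\<^sup>+\<omega>. (\<integral>\<^sup>+q. U q \<partial>transition M ?\<phi> (Suc i) (\<omega> i)) \<partial>path_law M ?\<phi> x)"
      by (rule nn_integral_path_Suc[OF \<phi> x, of "\<lambda>_. U"]) measurable
    also have "c i + ennreal \<alpha> * \<dots> =
        (\<integral>\<^sup>+\<omega>. live_cost M (\<omega> i) + ennreal \<alpha> * (\<integral>\<^sup>+q. U q \<partial>transition M ?\<phi> (Suc i) (\<omega> i)) \<partial>path_law M ?\<phi> x)"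
      unfolding c_def by (subst nn_integral_add) (auto simp: nn_integral_cmult)
    also have "\<dots> \<le> (\<integral>\<^sup>+\<omega>. U (\<omega> i) \<partial>path_law M ?\<phi> x)"
      by (intro nn_integral_mono step space_path_law[OF \<phi> x])
    finally show ?case .
  qed simp
  have "policy_value M \<alpha> ?\<phi> x = (\<Sum>k. ennreal \<alpha> ^ k * c k)"
    using \<alpha> by (simp add: policy_value_eq[OF \<phi> x] c_def ennreal_power)
  also have "\<dots> \<le> (\<integral>\<^sup>+\<omega>. U (\<omega> 0) \<partial>path_law M ?\<phi> x)"
  proof (rule suminf_le_const)
    show "(\<Sum>k<n. ennreal \<alpha> ^ k * c k) \<le> (\<integral>\<^sup>+\<omega>. U (\<omega> 0) \<partial>path_law M ?\<phi> x)" for n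
      using bound[where i = 0 and n = n] by simp
  qed simp
  also have "\<dots> \<le> v x"
    using act[OF x] by (simp add: nn_integral_path_0[OF \<phi> x U])
  finally show ?thesis .
qed

end

section \<open>The limit of value iteration at accumulation points\<close>

text \<open>Truncating the \<open>n\<close>th term of an increasing sequence at height \<open>n\<close> does not change its
  supremum. It replaces the value iteration functions, which may be infinite, by bounded functions.\<close>

lemma SUP_min_of_nat:
  fixes u :: "nat \<Rightarrow> ennreal"
  assumes "incseq u"
  shows "(SUP n. min (u n) (of_nat n)) = (SUP n. u n)"
proof -
  have "incseq (\<lambda>n. min (u n) (of_nat n))"
    by (intro monoI min.mono of_nat_mono incseqD[OF assms])
  then have "(\<lambda>n. min (u n) (of_nat n)) \<longlonglongrightarrow> (SUP n. min (u n) (of_nat n))"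
    by (rule LIMSEQ_SUP)
  moreover have "(\<lambda>n. min (u n) (of_nat n)) \<longlonglongrightarrow> min (SUP n. u n) top"
    by (intro tendsto_min LIMSEQ_SUP[OF assms] of_nat_tendsto_top_ennreal)
  ultimately show ?thesis using LIMSEQ_unique by fastforce
qed

context controlled
begin

text \<open>An infimum over uncountably many actions need not be measurable; here it is attained by a
  selector.\<close>

lemma measurable_value_iteration:
  assumes "value_iteration_policy M \<alpha> f"
  shows "value_iteration M \<alpha> n \<in> borel_measurable (live_space M)"
proof (induction n)
  case (Suc n)
  have f: "f (Suc n) \<in> selectors M"
    and eq: "x \<in> live M \<Longrightarrow> value_iteration M \<alpha> (Suc n) x
      = one_step_cost M \<alpha> (value_iteration M \<alpha> n) x (f (Suc n) x)" for x
    using assms unfolding value_iteration_policy_def by force+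
  have "value_iteration M \<alpha> (Suc n) \<in> borel_measurable (live_space M) \<longleftrightarrow>
      (\<lambda>x. one_step_cost M \<alpha> (value_iteration M \<alpha> n) x (f (Suc n) x)) \<in> borel_measurable (live_space M)"
    by (rule measurable_cong) (use eq in simp)
  with measurable_one_step_cost[OF Suc f] show ?case by blast
qed simp

lemma one_step_cost_SUP:
  assumes u: "incseq u" and meas: "\<And>n. u n \<in> borel_measurable (live_space M)" and p: "(x, a) \<in> live_pairs M"
  shows "one_step_cost M \<alpha> (\<lambda>y. SUP n. u n y) x a = (SUP n. one_step_cost M \<alpha> (u n) x a)"
proof -
  let ?g = "\<lambda>n y. u n y * indicator (live M) y"
  have inc: "incseq ?g"
    using u by (auto simp: incseq_def le_fun_def intro!: mult_right_mono)
  have g: "?g n \<in> borel_measurable (law M (x, a))" for n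
    using meas[of n] unfolding measurable_live_space_iff by (simp add: measurable_cong_sets[OF sets_law[OF p] refl])
  have inc': "incseq (\<lambda>n. \<integral>\<^sup>+y. ?g n y \<partial>law M (x, a))"
    using inc by (auto simp: incseq_def le_fun_def intro!: nn_integral_mono)
  have "(\<integral>\<^sup>+y\<in>live M. (SUP n. u n y) \<partial>law M (x, a)) = (\<integral>\<^sup>+y. (SUP n. ?g n y) \<partial>law M (x, a))"
    by (simp add: SUP_mult_right_ennreal)
  also have "\<dots> = (SUP n. \<integral>\<^sup>+y. ?g n y \<partial>law M (x, a))"
    by (rule nn_integral_monotone_convergence_SUP[OF inc g])
  finally show ?thesis
    unfolding one_step_cost_def by (simp add: SUP_mult_left_ennreal ennreal_SUP_add_right)
qed

text \<open>The strong Feller property, for bounded functions on \<open>live M\<close> with values in \<open>ennreal\<close>.\<close>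

lemma nn_integral_law_continuous:
  assumes Feller: "strongly_Feller M" and v: "v \<in> borel_measurable (live_space M)" and b: "\<And>y. v y \<le> of_nat m"
  obtains I where "\<And>p. p \<in> live_pairs M \<Longrightarrow> (\<integral>\<^sup>+y\<in>live M. v y \<partial>law M p) = ennreal (I p)"
    and "\<And>p. p \<in> live_pairs M \<Longrightarrow> 0 \<le> I p" and "continuous_on (live_pairs M) I"
proof -
  define g where "g y = enn2real (v y * indicator (live M) y)" for y
  define I where "I p = (\<integral>y. g y \<partial>law M p)" for p
  have gb: "v y * indicator (live M) y \<le> of_nat m" for y
    using b[of y] by (simp split: split_indicator)
  have g[measurable]: "g \<in> borel_measurable (state_space M)"
    using v unfolding measurable_live_space_iff g_def[abs_def] by measurable
  have fin: "v y * indicator (live M) y < top" for y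
    using gb[of y] by (rule le_less_trans) (simp add: of_nat_less_top)
  have ge: "ennreal (g y) = v y * indicator (live M) y" for y
    using fin[of y] by (simp add: g_def)
  have g0: "0 \<le> g y" for y by (simp add: g_def)
  have gm: "g y \<le> real m" for y
    using gb[of y] unfolding ge[symmetric] by (simp add: ennreal_of_nat_eq_real_of_nat)
  have "bounded (g ` states M)"
    unfolding bounded_iff using g0 gm by (intro exI[of _ "real m"]) auto
  with Feller g have "continuous_on (live_pairs M) I"
    unfolding strongly_Feller_def I_def[abs_def] by blast
  moreover have "(\<integral>\<^sup>+y\<in>live M. v y \<partial>law M p) = ennreal (I p)" if p: "p \<in> live_pairs M" for p
  proof -
    interpret prob_space "law M p" by (rule prob_space_law[OF p])
    have "integrable (law M p) g"
      using g0 gm by (intro integrable_const_bound[of _ "real m"])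
        (auto simp: measurable_cong_sets[OF sets_law[OF p] refl])
    from nn_integral_eq_integral[OF this] g0 show ?thesis by (simp add: ge I_def)
  qed
  moreover have "0 \<le> I p" for p unfolding I_def by (intro Bochner_Integration.integral_nonneg g0)
  ultimately show thesis using that by blast
qed

text \<open>The limit of the value iteration functions dominates its one-step cost at every accumulation
  point of the minimizers. Along a subsequence of the minimizers that converges to \<open>a\<close>, the one-step
  cost with a truncated value function \<open>u m\<close> is eventually at most the limit at \<open>x\<close>; lower
  semicontinuity of the cost and the strong Feller property pass this bound to \<open>a\<close>, and monotone
  convergence lets \<open>m\<close> tend to infinity.\<close>

lemma one_step_cost_accumulation_le:
  assumes \<alpha>: "0 < \<alpha>"
    and lsc: "lower_semicontinuous_on (live_pairs M) (cost M)" and pos: "\<forall>p\<in>live_pairs M. 0 \<le> cost M p"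
    and Feller: "strongly_Feller M" and VI: "value_iteration_policy M \<alpha> f"
    and x: "x \<in> live M" and a: "a \<in> feasible M x" and acc: "accumulation_point (\<lambda>n. f n x) a"
  shows "one_step_cost M \<alpha> (\<lambda>y. SUP n. value_iteration M \<alpha> n y) x a \<le> (SUP n. value_iteration M \<alpha> n x)"
proof -
  define u where "u m y = min (value_iteration M \<alpha> m y) (of_nat m)" for m y
  have p: "(x, a) \<in> live_pairs M" using x a by (simp add: live_pairs_def)
  have v_le: "value_iteration M \<alpha> m y \<le> value_iteration M \<alpha> n y" if "m \<le> n" for m n y
    using incseq_value_iteration[of M \<alpha>] that by (auto simp: incseq_def le_fun_def)
  have um: "u m \<in> borel_measurable (live_space M)" for m
    using measurable_value_iteration[OF VI] unfolding u_def[abs_def] by measurable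
  have "incseq u"
    by (auto simp: incseq_def le_fun_def u_def simp del: min.bounded_iff intro!: min.mono v_le of_nat_mono)
  moreover have "(SUP n. value_iteration M \<alpha> n y) = (SUP m. u m y)" for y
    unfolding u_def by (rule SUP_min_of_nat[symmetric]) (auto simp: incseq_def v_le)
  ultimately have eq: "one_step_cost M \<alpha> (\<lambda>y. SUP n. value_iteration M \<alpha> n y) x a = (SUP m. one_step_cost M \<alpha> (u m) x a)"
    using one_step_cost_SUP[OF _ um p] by simp
  have "one_step_cost M \<alpha> (u m) x a \<le> (SUP n. value_iteration M \<alpha> n x)" for m
  proof (cases "(SUP n. value_iteration M \<alpha> n x)")
    case (real B)
    obtain I where I: "\<And>p. p \<in> live_pairs M \<Longrightarrow> (\<integral>\<^sup>+y\<in>live M. u m y \<partial>law M p) = ennreal (I p)"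
        "\<And>p. p \<in> live_pairs M \<Longrightarrow> 0 \<le> I p" and cont: "continuous_on (live_pairs M) I"
      by (rule nn_integral_law_continuous[OF Feller um[of m], of m]) (auto simp: u_def)
    have cost_I: "one_step_cost M \<alpha> (u m) y b = ennreal (cost M (y, b) + \<alpha> * I (y, b))"
      if "(y, b) \<in> live_pairs M" for y b
      using that pos \<alpha> by (simp add: one_step_cost_def I ennreal_mult')
    obtain r :: "nat \<Rightarrow> nat" where r: "strict_mono r" and lim: "(\<lambda>j. f (r j) x) \<longlonglongrightarrow> a"
      using accumulation_point_subsequence[OF acc] by blast
    define s where "s j = (x, f (r j) x)" for j
    have s: "s j \<in> live_pairs M" for j
      using VI x by (simp add: s_def live_pairs_def value_iteration_policy_def selectors_def)
    have s_lim: "s \<longlonglongrightarrow> (x, a)" unfolding s_def by (intro tendsto_Pair tendsto_const lim)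
    have upper: "cost M (s j) + \<alpha> * I (s j) \<le> B" if j: "Suc m \<le> j" for j
    proof -
      have rj: "Suc m \<le> r j" using j seq_suble[OF r, of j] by simp
      have "ennreal (cost M (s j) + \<alpha> * I (s j)) = one_step_cost M \<alpha> (u m) x (f (r j) x)"
        using cost_I s[of j] by (simp add: s_def)
      also have "\<dots> \<le> one_step_cost M \<alpha> (value_iteration M \<alpha> (r j - 1)) x (f (r j) x)"
        using rj by (intro one_step_cost_mono) (auto simp: le_fun_def u_def intro!: min.coboundedI1 v_le)
      also have "\<dots> = value_iteration M \<alpha> (r j) x"
        using VI rj x by (simp add: value_iteration_policy_def)
      also have "\<dots> \<le> ennreal B"
        unfolding real(2)[symmetric] by (rule SUP_upper) simp
      finally show ?thesis using real(1) by (simp add: ennreal_le_iff)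
    qed
    have "cost M (x, a) + \<alpha> * I (x, a) \<le> B"
    proof (rule field_le_epsilon)
      fix e :: real assume e: "0 < e"
      have "ereal (cost M (x, a)) \<le> liminf (\<lambda>j. ereal (cost M (s j)))"
        using lsc s p s_lim unfolding lower_semicontinuous_on_def by blast
      then have "ereal (cost M (x, a) - e / 2) < liminf (\<lambda>j. ereal (cost M (s j)))"
        by (rule less_le_trans[rotated]) (use e in simp)
      then have 1: "\<forall>\<^sub>F j in sequentially. ereal (cost M (x, a) - e / 2) < ereal (cost M (s j))"
        by (rule less_LiminfD)
      \<comment> \<open>The strong Feller property enters here, through the continuity of \<open>I\<close>.\<close>
      have "(\<lambda>j. I (s j)) \<longlonglongrightarrow> I (x, a)"
        using cont s p s_lim unfolding continuous_on_sequentially comp_def by blast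
      then have "(\<lambda>j. \<alpha> * I (s j)) \<longlonglongrightarrow> \<alpha> * I (x, a)" by (intro tendsto_intros)
      then have 2: "\<forall>\<^sub>F j in sequentially. \<alpha> * I (x, a) - e / 2 < \<alpha> * I (s j)"
        by (rule order_tendstoD) (use e in simp)
      obtain j where "ereal (cost M (x, a) - e / 2) < ereal (cost M (s j))"
        "\<alpha> * I (x, a) - e / 2 < \<alpha> * I (s j)" "Suc m \<le> j"
        using eventually_happens'[OF _ eventually_conj[OF 1 eventually_conj[OF 2 eventually_ge_at_top[of "Suc m"]]]]
        by auto
      with upper[of j] show "cost M (x, a) + \<alpha> * I (x, a) \<le> B + e" by simp
    qed
    then show ?thesis
      unfolding real(2) by (simp add: cost_I[OF p] ennreal_leI)
  next
    case top
    show ?thesis unfolding top by (rule top_greatest)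
  qed
  then show ?thesis unfolding eq by (intro SUP_least)
qed

end

section \<open>Optimality of a selector of accumulation points\<close>

theorem proposition5p2:
  fixes M :: "('x::polish_space, 'a::polish_space) model"
    and \<alpha> :: real
    and fhat :: "nat \<Rightarrow> 'x \<Rightarrow> 'a"
  assumes "control_model M"
    and "0 < \<alpha>" and "\<alpha> < 1"
    and "\<forall>x\<in>states M. compact (feasible M x)"
    and "lower_semicontinuous_on (live_pairs M) (cost M)"
    and "\<forall>p\<in>live_pairs M. 0 \<le> cost M p"
    and "inf_compact M (cost M)"
    and "strongly_Feller M"
    and "locally_compact_space (top_of_set (actions M))"
    and "value_iteration_policy M \<alpha> fhat"
  shows "\<exists>f\<in>selectors M.
           (\<forall>x\<in>live M. f x \<in> feasible M x \<and> accumulation_point (\<lambda>n. fhat n x) (f x)) \<and>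
           discount_optimal M \<alpha> (stationary M f)"
proof -
  interpret controlled M by unfold_locales fact
  note VI = \<open>value_iteration_policy M \<alpha> fhat\<close>
  have fhat: "fhat n \<in> selectors M" for n
    using VI by (simp add: value_iteration_policy_def)
  have "fhat n \<in> borel_measurable (live_space M)" for n
    using fhat[of n] unfolding selectors_def action_space_def measurable_restrict_space2_iff by simp
  then obtain f where f: "f \<in> borel_measurable (live_space M)" "\<And>x. x \<in> live M \<Longrightarrow> f x \<in> feasible M x"
      "\<And>x. x \<in> live M \<Longrightarrow> accumulation_point (\<lambda>n. fhat n x) (f x)"
  proof (rule measurable_accumulation_selector[of fhat "live_space M" "feasible M"], simp_all)
    show "compact (feasible M x)" if "x \<in> live M" for x
      using assms(4) live_subset that by blast
    show "fhat n x \<in> feasible M x" if "x \<in> live M" for x n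
      using fhat[of n] that by (simp add: selectors_def)
  qed
  have "f x \<in> actions M" if "x \<in> live M" for x
    using f(2)[OF that] feasible_subset[of x] live_subset that by blast
  then have f_sel: "f \<in> selectors M"
    using f(1,2) by (auto simp: selectors_def action_space_def measurable_restrict_space2_iff)
  define V where "V x = (SUP n. value_iteration M \<alpha> n x)" for x
  note meas = measurable_value_iteration[OF VI]
  then have V: "V \<in> borel_measurable (live_space M)" unfolding V_def[abs_def] by measurable
  have excessive: "one_step_cost M \<alpha> V y (f y) \<le> V y" if "y \<in> live M" for y
    using one_step_cost_accumulation_le[OF assms(2,5,6,8) VI that f(2,3)[OF that]] by (simp add: V_def[abs_def])
  have "policy_value M \<alpha> (stationary M f) x = optimal_value M \<alpha> x" if x: "x \<in> live M" for x
  proof (rule antisym)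
    have "V x \<le> optimal_value M \<alpha> x"
      unfolding V_def optimal_value_def
      by (intro SUP_least INF_greatest policy_value_ge_value_iteration assms(2) meas x)
    with policy_value_stationary_le[OF assms(2) V f_sel excessive x]
    show "policy_value M \<alpha> (stationary M f) x \<le> optimal_value M \<alpha> x" by simp
    show "optimal_value M \<alpha> x \<le> policy_value M \<alpha> (stationary M f) x"
      unfolding optimal_value_def by (rule INF_lower[OF stationary_in_policies[OF f_sel]])
  qed
  then have "discount_optimal M \<alpha> (stationary M f)"
    using stationary_in_policies[OF f_sel] by (simp add: discount_optimal_def)
  with f f_sel show ?thesis by blast
qed

end
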